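(* Let $D$ be a digraph. If $\vec{\chi}(D) = \Delta_{\min}(D)+1$, then $D$ contains the complete bidirected graph on $\left\lceil \frac{\Delta_{\min}(D)+1}{2} \right\rceil$ vertices as a subdigraph.
   Context: Digraphs are finite, without loops or parallel arcs; two arcs in opposite directions between the same two vertices are allowed. For a vertex $v$, $d^+(v)$ and $d^-(v)$ denote its out-degree and in-degree, and $\Delta_{\min}(D)=\max_{v\in V(D)} \min\{d^+(v),d^-(v)\}$. A $k$-dicolouring of $D$ is a function $c:V(D)\to\{1,\dots,k\}$ such that for each $i$ the set $c^{-1}(i)$ induces a subdigraph with no directed cycle (a pair of opposite arcs between two vertices is a directed cycle of length 2). The dichromatic number $\vec{\chi}(D)$ is the smallest $k$ such that $D$ has a $k$-dicolouring. The complete bidirected graph on $m$ vertices is the digraph on $m$ vertices in which every ordered pair of distinct vertices is an arc. Subdigraphs are not required to be induced. *)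

theory Defs
  imports Complex_Main "Graph_Theory.Graph_Theory"
begin

definition acyclic_digraph :: "('a, 'b) pre_digraph \<Rightarrow> bool" where
  "acyclic_digraph D \<longleftrightarrow> (\<nexists>p. pre_digraph.cycle D p)"

(* The library's cycle has no lower bound on its length beyond being non-empty, so a pair of
   opposite arcs is a cycle. *)
definition dicolouring :: "('a, 'b) pre_digraph \<Rightarrow> nat \<Rightarrow> ('a \<Rightarrow> nat) \<Rightarrow> bool" where
  "dicolouring D k c \<longleftrightarrow>
     c ` verts D \<subseteq> {1..k} \<and>
     (\<forall>i\<in>{1..k}. acyclic_digraph (D \<restriction> {v \<in> verts D. c v = i}))"

(* On a finite loopless digraph the set of such k is non-empty: colour the vertices injectively. *)
definition dichromatic_number :: "('a, 'b) pre_digraph \<Rightarrow> nat" where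
  "dichromatic_number D = (LEAST k. \<exists>c. dicolouring D k c)"

(* Unspecified on the digraph without vertices, whose dichromatic number is 0 and hence
   never of the form Delta_min D + 1. *)
definition Delta_min :: "('a, 'b) pre_digraph \<Rightarrow> nat" where
  "Delta_min D = Max ((\<lambda>v. min (out_degree D v) (in_degree D v)) ` verts D)"

end

theory Submission
  imports Defs
begin

text \<open>
  Write \<open>k\<close> for \<open>Delta_min D\<close>. A digraph with dichromatic number \<open>k + 1\<close> is not \<open>k\<close>-dicolourable.
  The proof of the claim from this has two parts.

  \<^bold>\<open>Folding.\<close> Let \<open>X\<close> be the set of vertices of out-degree at most \<open>k\<close>; the remaining vertices have
  in-degree at most \<open>k\<close>. Keep the arcs inside \<open>X\<close>, reverse those outside \<open>X\<close>, make every arc leaving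
  \<open>X\<close> bidirected and drop every arc entering \<open>X\<close>. In the new digraph every out-degree is at most \<open>k\<close>,
  and a set that is acyclic there is acyclic in \<open>D\<close>: it cannot contain an arc leaving \<open>X\<close>, so a cycle
  of \<open>D\<close> in it would stay on one side (\<open>acyclic_fold_arcs\<close>). So the folded digraph is not
  \<open>k\<close>-dicolourable either. If it contains a complete bidirected digraph on \<open>k + 1\<close> vertices, then one
  of the two sides contains at least half of these vertices, and on one side folding only keeps or
  reverses all arcs, so this half is complete in \<open>D\<close> as well.

  \<^bold>\<open>A directed Brooks theorem for out-degrees.\<close> A minimal vertex set of the folded digraph that is not
  \<open>k\<close>-dicolourable has all out-degrees and, by counting arcs, all in-degrees equal to \<open>k\<close>
  (\<open>exists_critical_regular\<close>). For \<open>k \<ge> 2\<close> such a digraph contains a complete bidirected digraph on \<open>k + 1\<close> vertices, or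
  \<open>k = 2\<close> and all its arcs come in opposite pairs (\<open>complete_or_bidirected\<close>). In the second case the
  partition into the two sides of the folding is not a 2-dicolouring, so some side contains a pair of
  opposite arcs, which is what is needed for \<open>k = 2\<close>.

  The theorem on critical regular digraphs is proved by sliding a hole as in the 15-puzzle. Colour all
  vertices but one, the hole \<open>x\<close>. Every colour occurs exactly once among the out-neighbours and
  once among the in-neighbours of \<open>x\<close>, so any neighbour \<open>u\<close> of \<open>x\<close> can become the new hole, after \<open>x\<close>
  has received the colour of \<open>u\<close>. Fix one colour class \<open>T\<close> and let \<open>A\<close> be the component of \<open>x\<close> outside
  \<open>T\<close>. The hole moves freely in \<open>A\<close> without changing \<open>T\<close>, so \<open>A\<close> is \<open>(k - 1)\<close>-regular; moreover \<open>A\<close>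
  stays connected when a vertex is deleted (\<open>comp_minus_connected\<close>). If some neighbour in \<open>T\<close> of a
  vertex \<open>a\<close> of \<open>A\<close> has a second neighbour in \<open>A\<close>, this forces a complete digraph on \<open>k + 1\<close>
  vertices (\<open>exists_complete\<close>). Otherwise let the hole leave \<open>A\<close> through \<open>a\<close>, enter \<open>T\<close>, and
  continue from the new component in the same way. The set \<open>A - {a}\<close> left behind can never be touched by the
  hole again (\<open>hole_trail_extend\<close>), so the sets left behind grow without bound, which is absurd. Such a trail
  can be started unless all arcs come in opposite pairs and \<open>k = 2\<close>, the case of odd cycles.
\<close>

section \<open>Acyclic vertex sets\<close>

lemma acyclic_Restr_iff_sink:
  assumes "finite S"
  shows "acyclic (Restr E S) \<longleftrightarrow>
    (\<forall>S'\<subseteq>S. S' \<noteq> {} \<longrightarrow> (\<exists>v\<in>S'. \<forall>w\<in>S'. (v, w) \<notin> E))"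
proof
  assume ac: "acyclic (Restr E S)"
  have "finite (Restr E S)" using assms by simp
  then have wf: "wf ((Restr E S)\<inverse>)" using ac by (simp add: finite_acyclic_wf_converse)
  show "\<forall>S'\<subseteq>S. S' \<noteq> {} \<longrightarrow> (\<exists>v\<in>S'. \<forall>w\<in>S'. (v, w) \<notin> E)"
  proof (intro allI impI)
    fix S' assume "S' \<subseteq> S" "S' \<noteq> {}"
    then obtain x where "x \<in> S'" by blast
    then obtain v where "v \<in> S'" "\<And>w. (w, v) \<in> (Restr E S)\<inverse> \<Longrightarrow> w \<notin> S'"
      using wfE_min[OF wf] by metis
    then show "\<exists>v\<in>S'. \<forall>w\<in>S'. (v, w) \<notin> E" using \<open>S' \<subseteq> S\<close> by blast
  qed
next
  assume sink: "\<forall>S'\<subseteq>S. S' \<noteq> {} \<longrightarrow> (\<exists>v\<in>S'. \<forall>w\<in>S'. (v, w) \<notin> E)"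
  show "acyclic (Restr E S)"
  proof (rule acyclicI, intro allI notI)
    fix x assume x: "(x, x) \<in> (Restr E S)\<^sup>+"
    let ?C = "{y. (x, y) \<in> (Restr E S)\<^sup>+ \<and> (y, x) \<in> (Restr E S)\<^sup>+}"
    have "?C \<subseteq> S" by (auto elim: tranclE)
    moreover have "x \<in> ?C" using x by simp
    ultimately obtain v where v: "v \<in> ?C" "\<forall>w\<in>?C. (v, w) \<notin> E" using sink by blast
    then obtain w where w: "(v, w) \<in> Restr E S" "(w, x) \<in> (Restr E S)\<^sup>*"
      by (auto dest: tranclD)
    have "(x, w) \<in> (Restr E S)\<^sup>+" using v(1) w(1) by (auto intro: trancl_into_trancl)
    moreover have "(w, x) \<in> (Restr E S)\<^sup>+"
      using rtranclD[OF w(2)] x by auto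
    ultimately show False using v(2) w(1) by blast
  qed
qed

text \<open>A sink of the part in \<open>A\<close>, if there is one, is a sink of the whole.\<close>

lemma acyclic_Restr_Un:
  assumes "finite A" "finite B" "acyclic (Restr E A)" "acyclic (Restr E B)"
    and no: "E \<inter> A \<times> B = {}"
  shows "acyclic (Restr E (A \<union> B))"
proof (rule iffD2[OF acyclic_Restr_iff_sink], goal_cases)
  case 1
  then show ?case using assms by simp
next
  case 2
  note sinkA = iffD1[OF acyclic_Restr_iff_sink[OF assms(1)] assms(3), rule_format]
  note sinkB = iffD1[OF acyclic_Restr_iff_sink[OF assms(2)] assms(4), rule_format]
  show ?case
  proof (intro allI impI)
    fix S assume S: "S \<subseteq> A \<union> B" "S \<noteq> {}"
    show "\<exists>v\<in>S. \<forall>w\<in>S. (v, w) \<notin> E"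
    proof (cases "S \<inter> A = {}")
      case True
      then have "S \<subseteq> B" using S by blast
      then show ?thesis using sinkB S by blast
    next
      case False
      then obtain v where "v \<in> S \<inter> A" "\<forall>w\<in>S \<inter> A. (v, w) \<notin> E"
        using sinkA[of "S \<inter> A"] by blast
      then show ?thesis using S no by blast
    qed
  qed
qed

lemma acyclic_Restr_subset:
  assumes "acyclic (Restr E B)" "A \<subseteq> B"
  shows "acyclic (Restr E A)"
  by (rule acyclic_subset[OF assms(1)]) (use assms(2) in blast)

lemma acyclic_Restr_insert:
  assumes "finite A" "acyclic (Restr E A)" "(x, x) \<notin> E"
    and "E `` {x} \<inter> A = {} \<or> E\<inverse> `` {x} \<inter> A = {}"
  shows "acyclic (Restr E (insert x A))"
proof -
  have "Restr E {x} = {}" using assms(3) by auto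
  then have x: "acyclic (Restr E {x})" by (simp add: acyclic_def)
  from assms(4) have "acyclic (Restr E ({x} \<union> A)) \<or> acyclic (Restr E (A \<union> {x}))"
  proof
    assume "E `` {x} \<inter> A = {}"
    then show ?thesis using assms x by (intro disjI1 acyclic_Restr_Un) auto
  next
    assume "E\<inverse> `` {x} \<inter> A = {}"
    then show ?thesis using assms x by (intro disjI2 acyclic_Restr_Un) auto
  qed
  then show ?thesis by simp
qed

lemma acyclic_Restr_converse: "acyclic (Restr (E\<inverse>) S) \<longleftrightarrow> acyclic (Restr E S)"
proof -
  have "Restr (E\<inverse>) S = (Restr E S)\<inverse>" by blast
  then show ?thesis by (simp only: acyclic_converse)
qed

section \<open>Dicolourings, holes and components\<close>

definition colours :: "('a \<times> 'a) set \<Rightarrow> 'a set \<Rightarrow> nat \<Rightarrow> ('a \<Rightarrow> nat) \<Rightarrow> bool" where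
  "colours E S k c \<longleftrightarrow> c ` S \<subseteq> {..<k} \<and> (\<forall>i<k. acyclic (Restr E {v \<in> S. c v = i}))"

definition dicolourable :: "('a \<times> 'a) set \<Rightarrow> 'a set \<Rightarrow> nat \<Rightarrow> bool" where
  "dicolourable E S k \<longleftrightarrow> (\<exists>c. colours E S k c)"

definition hole_colouring :: "('a \<times> 'a) set \<Rightarrow> 'a set \<Rightarrow> nat \<Rightarrow> ('a \<Rightarrow> nat) \<Rightarrow> 'a \<Rightarrow> bool" where
  "hole_colouring E V k c x \<longleftrightarrow> x \<in> V \<and> colours E (V - {x}) k c"

text \<open>A configuration of the hole puzzle: the hole \<open>x\<close> and one distinguished colour class \<open>T\<close>. The other
  colours are forgotten, since they may be rearranged while the hole moves outside \<open>T\<close>.\<close>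

definition state :: "('a \<times> 'a) set \<Rightarrow> 'a set \<Rightarrow> nat \<Rightarrow> 'a set \<Rightarrow> 'a \<Rightarrow> bool" where
  "state E V k T x \<longleftrightarrow> (\<exists>c. \<exists>j<k. hole_colouring E V k c x \<and> T = {v \<in> V - {x}. c v = j})"

text \<open>The component of \<open>x\<close> in the underlying undirected graph of the subdigraph induced by \<open>U\<close>.\<close>

definition component :: "('a \<times> 'a) set \<Rightarrow> 'a set \<Rightarrow> 'a \<Rightarrow> 'a set" where
  "component E U x = (Restr (E \<union> E\<inverse>) U)\<^sup>* `` {x}"

definition complete_on :: "('a \<times> 'a) set \<Rightarrow> 'a set \<Rightarrow> bool" where
  "complete_on E K \<longleftrightarrow> (\<forall>u\<in>K. \<forall>w\<in>K. u \<noteq> w \<longrightarrow> (u, w) \<in> E)"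

text \<open>Reversing all arcs changes none of these notions. This gives every statement about out-neighbours
  a counterpart for in-neighbours.\<close>

lemma colours_converse [simp]: "colours (E\<inverse>) = colours E"
  by (simp add: colours_def acyclic_Restr_converse fun_eq_iff)

lemma dicolourable_converse [simp]: "dicolourable (E\<inverse>) = dicolourable E"
  by (simp add: dicolourable_def fun_eq_iff)

lemma hole_colouring_converse [simp]: "hole_colouring (E\<inverse>) = hole_colouring E"
  by (simp add: hole_colouring_def fun_eq_iff)

lemma state_converse [simp]: "state (E\<inverse>) = state E"
  by (simp add: state_def fun_eq_iff)

lemma component_converse [simp]: "component (E\<inverse>) = component E"
  by (simp add: component_def fun_eq_iff Un_commute)

lemma complete_on_converse [simp]: "complete_on (E\<inverse>) = complete_on E"
  by (rule ext) (auto simp: complete_on_def)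

lemma component_refl: "x \<in> component E U x"
  by (simp add: component_def)

lemma component_induct [consumes 1, case_names base step]:
  assumes "a \<in> component E U x" "P x"
    and "\<And>a w. a \<in> component E U x \<Longrightarrow> P a \<Longrightarrow> w \<in> component E U x \<Longrightarrow> w \<in> U \<Longrightarrow> (a, w) \<in> E \<union> E\<inverse> \<Longrightarrow> P w"
  shows "P a"
proof -
  have "(x, a) \<in> (Restr (E \<union> E\<inverse>) U)\<^sup>*" using assms(1) by (simp add: component_def)
  then show ?thesis
  proof (induction rule: rtrancl_induct)
    case base
    then show ?case by (rule assms(2))
  next
    case (step a w)
    have "a \<in> component E U x" "w \<in> component E U x"
      using step.hyps(1) rtrancl_into_rtrancl[OF step.hyps] by (simp_all add: component_def)
    then show ?case using assms(3)[of a w] step.hyps(2) step.IH by blast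
  qed
qed

lemma component_least:
  assumes "a \<in> S" and "\<And>u w. u \<in> S \<Longrightarrow> w \<in> U \<Longrightarrow> (u, w) \<in> E \<union> E\<inverse> \<Longrightarrow> w \<in> S"
  shows "component E U a \<subseteq> S"
proof
  fix b assume "b \<in> component E U a"
  then show "b \<in> S"
  proof (induction rule: component_induct)
    case base
    show ?case by (rule assms(1))
  next
    case (step u w)
    then show ?case using assms(2)[of u w] by blast
  qed
qed

lemma component_subset:
  assumes "x \<in> U"
  shows "component E U x \<subseteq> U"
proof
  fix a assume "a \<in> component E U x"
  then show "a \<in> U" by (rule component_induct) (use assms in simp_all)
qed

lemma component_closed:
  assumes "a \<in> component E U x" "x \<in> U" "w \<in> U" "(a, w) \<in> E \<union> E\<inverse>"
  shows "w \<in> component E U x"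
proof -
  have "a \<in> U" by (rule subsetD[OF component_subset[OF assms(2)] assms(1)])
  then have "(a, w) \<in> Restr (E \<union> E\<inverse>) U" using assms(3,4) by simp
  then show ?thesis using assms(1) rtrancl_into_rtrancl[of x a "Restr (E \<union> E\<inverse>) U" w]
    by (simp add: component_def)
qed

lemma component_eq:
  assumes "a \<in> component E U x"
  shows "component E U a = component E U x"
proof -
  let ?R = "Restr (E \<union> E\<inverse>) U"
  have "sym (?R\<^sup>*)" by (rule sym_rtrancl) (auto simp: sym_def)
  moreover have xa: "(x, a) \<in> ?R\<^sup>*" using assms by (simp add: component_def)
  ultimately have ax: "(a, x) \<in> ?R\<^sup>*" by (rule symD)
  have "(a, y) \<in> ?R\<^sup>* \<longleftrightarrow> (x, y) \<in> ?R\<^sup>*" for y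
    using rtrancl_trans[OF ax] rtrancl_trans[OF xa] by blast
  then show ?thesis unfolding component_def by blast
qed

lemma colours_extend:
  assumes c: "colours E (V - {x}) k c" and x: "x \<in> V" and i: "i < k"
    and ac: "acyclic (Restr E (insert x {v \<in> V - {x}. c v = i}))"
  shows "colours E V k (c(x := i))"
  unfolding colours_def
proof (intro conjI allI impI)
  show "(c(x := i)) ` V \<subseteq> {..<k}" using c i by (auto simp: colours_def)
  fix j assume "j < k"
  show "acyclic (Restr E {v \<in> V. (c(x := i)) v = j})"
  proof (cases "j = i")
    case True
    then have "{v \<in> V. (c(x := i)) v = j} = insert x {v \<in> V - {x}. c v = i}" using x by auto
    then show ?thesis using ac by simp
  next
    case False
    then have "{v \<in> V. (c(x := i)) v = j} = {v \<in> V - {x}. c v = j}" by auto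
    then show ?thesis using c \<open>j < k\<close> by (simp add: colours_def)
  qed
qed

text \<open>A colour missing among the out-neighbours of \<open>x\<close> could be given to \<open>x\<close>: no cycle of that class can
  then leave \<open>x\<close>.\<close>

lemma uncolourable_sees_every_colour:
  assumes "finite V" "(x, x) \<notin> E" "\<not> dicolourable E V k" "x \<in> V"
    and c: "colours E (V - {x}) k c" and i: "i < k"
  shows "\<exists>u\<in>V - {x}. (x, u) \<in> E \<and> c u = i"
proof (rule ccontr)
  assume no: "\<not> (\<exists>u\<in>V - {x}. (x, u) \<in> E \<and> c u = i)"
  let ?C = "{v \<in> V - {x}. c v = i}"
  have "E `` {x} \<inter> ?C = {}" using no by blast
  moreover have "acyclic (Restr E ?C)" using c i by (simp add: colours_def)
  moreover have "finite ?C" using assms(1) by simp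
  ultimately have "acyclic (Restr E (insert x ?C))"
    using assms(2) by (intro acyclic_Restr_insert disjI1)
  then have "colours E V k (c(x := i))" by (rule colours_extend[OF c assms(4) i])
  then show False using assms(3) by (auto simp: dicolourable_def)
qed

lemma uncolourable_degree:
  assumes "finite V" "(x, x) \<notin> E" "\<not> dicolourable E V k" "x \<in> V" "dicolourable E (V - {x}) k"
  shows "k \<le> card (E `` {x} \<inter> V)"
proof -
  obtain c where c: "colours E (V - {x}) k c" using assms(5) by (auto simp: dicolourable_def)
  have "{..<k} \<subseteq> c ` (E `` {x} \<inter> V)"
    using uncolourable_sees_every_colour[OF assms(1-4) c] by blast
  then have "card {..<k} \<le> card (E `` {x} \<inter> V)"
    using assms(1) by (intro surj_card_le) auto
  then show ?thesis by simp
qed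

section \<open>Sliding the hole in a critical regular digraph\<close>

locale critical_regular =
  fixes E :: "('a \<times> 'a) set" and V :: "'a set" and k :: nat
  assumes finite_V: "finite V"
    and arcs_V: "E \<subseteq> V \<times> V"
    and no_loop: "(v, v) \<notin> E"
    and out_deg: "v \<in> V \<Longrightarrow> card (E `` {v}) = k"
    and in_deg: "v \<in> V \<Longrightarrow> card (E\<inverse> `` {v}) = k"
    and two_le_k: "2 \<le> k"
    and not_dicolourable: "\<not> dicolourable E V k"
    and critical: "v \<in> V \<Longrightarrow> dicolourable E (V - {v}) k"
begin

lemma reversed: "critical_regular (E\<inverse>) V k"
  using finite_V arcs_V no_loop out_deg in_deg two_le_k not_dicolourable critical
  by unfold_locales auto

lemma finite_out: "finite (E `` {v})"
  by (rule finite_subset[OF _ finite_V]) (use arcs_V in auto)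

lemma hole_class_cyclic:
  assumes h: "hole_colouring E V k c x" and i: "i < k"
  shows "\<not> acyclic (Restr E (insert x {v \<in> V - {x}. c v = i}))"
proof
  assume ac: "acyclic (Restr E (insert x {v \<in> V - {x}. c v = i}))"
  have x: "x \<in> V" and c: "colours E (V - {x}) k c" using h by (auto simp: hole_colouring_def)
  have "colours E V k (c(x := i))" by (rule colours_extend[OF c x i ac])
  then show False using not_dicolourable by (auto simp: dicolourable_def)
qed

text \<open>All \<open>k\<close> colours have to occur among the \<open>k\<close> out-neighbours of the hole, so none occurs twice.\<close>

lemma hole_out_nbr:
  assumes h: "hole_colouring E V k c x" and i: "i < k"
  shows "\<exists>!u. (x, u) \<in> E \<and> c u = i"
proof -
  have x: "x \<in> V" and c: "colours E (V - {x}) k c" using h by (auto simp: hole_colouring_def)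
  have nbrs: "E `` {x} \<subseteq> V - {x}" using arcs_V no_loop by auto
  have ex: "\<exists>u. (x, u) \<in> E \<and> c u = j" if j: "j < k" for j
    using uncolourable_sees_every_colour[OF finite_V no_loop not_dicolourable x c j] by blast
  have "c ` (E `` {x}) = {..<k}"
    using ex c nbrs by (fastforce simp: colours_def image_iff)
  then have "inj_on c (E `` {x})"
    using out_deg[OF x] finite_out by (intro eq_card_imp_inj_on) auto
  then show ?thesis using ex[OF i] by (auto dest: inj_onD)
qed

text \<open>Giving \<open>x\<close> the colour of \<open>u\<close> closes no cycle, because \<open>u\<close> was the only out-neighbour of \<open>x\<close> of that
  colour and is now uncoloured.\<close>

lemma hole_slide_out:
  assumes h: "hole_colouring E V k c x" and u: "(x, u) \<in> E"
  shows "hole_colouring E V k (c(x := c u)) u"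
proof -
  have x: "x \<in> V" and c: "colours E (V - {x}) k c" using h by (auto simp: hole_colouring_def)
  have uV: "u \<in> V" "u \<noteq> x" using u arcs_V no_loop by auto
  have cu: "c u < k" using c uV by (auto simp: colours_def)
  have "colours E (V - {u}) k (c(x := c u))"
    unfolding colours_def
  proof (intro conjI allI impI)
    show "(c(x := c u)) ` (V - {u}) \<subseteq> {..<k}" using c cu by (auto simp: colours_def)
    fix i assume i: "i < k"
    let ?C = "{v \<in> V - {u} - {x}. c v = i}"
    have ac: "acyclic (Restr E ?C)"
      by (rule acyclic_Restr_subset[of _ "{v \<in> V - {x}. c v = i}"])
        (use c i in \<open>auto simp: colours_def\<close>)
    show "acyclic (Restr E {v \<in> V - {u}. (c(x := c u)) v = i})"
    proof (cases "i = c u")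
      case True
      have "E `` {x} \<inter> ?C = {}"
        using hole_out_nbr[OF h i] u True by auto
      then have "acyclic (Restr E (insert x ?C))"
        using ac no_loop finite_V by (intro acyclic_Restr_insert) auto
      moreover have "{v \<in> V - {u}. (c(x := c u)) v = i} = insert x ?C"
        using True x uV by auto
      ultimately show ?thesis by simp
    next
      case False
      then have "{v \<in> V - {u}. (c(x := c u)) v = i} = ?C" by auto
      then show ?thesis using ac by simp
    qed
  qed
  then show ?thesis using uV by (simp add: hole_colouring_def)
qed

lemma hole_slide:
  assumes "hole_colouring E V k c x" "(x, u) \<in> E \<union> E\<inverse>"
  shows "hole_colouring E V k (c(x := c u)) u"
  using assms hole_slide_out critical_regular.hole_slide_out[OF reversed, of c x u] by auto

lemma state_out_nbr:
  assumes "state E V k T x"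
  shows "\<exists>!t. (x, t) \<in> E \<and> t \<in> T"
proof -
  obtain c j where "hole_colouring E V k c x" and j: "j < k" and T: "T = {v \<in> V - {x}. c v = j}"
    using assms by (auto simp: state_def)
  then have "\<exists>!t. (x, t) \<in> E \<and> c t = j" using hole_out_nbr by blast
  moreover have "(x, t) \<in> E \<and> t \<in> T \<longleftrightarrow> (x, t) \<in> E \<and> c t = j" for t
    using T arcs_V no_loop by auto
  ultimately show ?thesis by simp
qed

lemmas state_in_nbr =
  critical_regular.state_out_nbr[OF reversed, simplified, unfolded converse_iff]

lemma state_props:
  assumes "state E V k T x"
  shows "x \<in> V" "T \<subseteq> V" "x \<notin> T" "finite T" "acyclic (Restr E T)" "\<not> acyclic (Restr E (insert x T))"
proof -
  obtain c j where c: "hole_colouring E V k c x" "j < k" "T = {v \<in> V - {x}. c v = j}"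
    using assms by (auto simp: state_def)
  show "x \<in> V" "T \<subseteq> V" "x \<notin> T" "finite T" "acyclic (Restr E T)" "\<not> acyclic (Restr E (insert x T))"
    using c hole_class_cyclic[OF c(1,2)] finite_V by (auto simp: hole_colouring_def colours_def)
qed

text \<open>The hole enters \<open>T\<close> at \<open>t\<close>. The vertices outside \<open>T\<close> other than the hole stay the same.\<close>

lemma state_slide_in:
  assumes "state E V k T x" "t \<in> T" "(x, t) \<in> E \<union> E\<inverse>"
  shows "state E V k (insert x (T - {t})) t"
proof -
  obtain c j where c: "hole_colouring E V k c x" "j < k" "T = {v \<in> V - {x}. c v = j}"
    using assms by (auto simp: state_def)
  have "hole_colouring E V k (c(x := c t)) t" using c assms by (intro hole_slide) auto
  moreover have "insert x (T - {t}) = {v \<in> V - {t}. (c(x := c t)) v = j}"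
    using c assms by (auto simp: hole_colouring_def)
  ultimately show ?thesis using c(2) unfolding state_def by blast
qed

lemma state_slide_within:
  assumes "state E V k T x" "u \<in> V - T" "(x, u) \<in> E \<union> E\<inverse>"
  shows "state E V k T u"
proof -
  obtain c j where c: "hole_colouring E V k c x" "j < k" "T = {v \<in> V - {x}. c v = j}"
    using assms by (auto simp: state_def)
  have ne: "u \<noteq> x" using assms no_loop by auto
  have "hole_colouring E V k (c(x := c u)) u" using c assms by (intro hole_slide) auto
  moreover have "T = {v \<in> V - {u}. (c(x := c u)) v = j}"
    using c assms ne by (auto simp: hole_colouring_def)
  ultimately show ?thesis using c(2) unfolding state_def by blast
qed

abbreviation comp :: "'a set \<Rightarrow> 'a \<Rightarrow> 'a set" where
  "comp T x \<equiv> component E (V - T) x"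

lemma state_within_comp:
  assumes "a \<in> comp T x" "state E V k T x"
  shows "state E V k T a"
  using assms by (induction rule: component_induct) (auto intro: state_slide_within)

lemma comp_subset:
  assumes "state E V k T x"
  shows "comp T x \<subseteq> V - T"
  using component_subset[of x "V - T" E] state_props[OF assms] by blast

lemma comp_closed:
  assumes "state E V k T x" "a \<in> comp T x" "w \<in> V - T" "(a, w) \<in> E \<union> E\<inverse>"
  shows "w \<in> comp T x"
  using component_closed[OF assms(2) _ assms(3,4)] state_props[OF assms(1)] by blast

text \<open>With the hole at \<open>a\<close>, exactly one out-neighbour of \<open>a\<close> lies in \<open>T\<close>; the others lie in the component.\<close>

lemma comp_out_deg:
  assumes st: "state E V k T x" and a: "a \<in> comp T x"
  shows "card (E `` {a} \<inter> comp T x) = k - 1"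
proof -
  have sta: "state E V k T a" using state_within_comp a st .
  obtain t where t: "(a, t) \<in> E" "t \<in> T" and uniq: "\<And>t'. (a, t') \<in> E \<Longrightarrow> t' \<in> T \<Longrightarrow> t' = t"
    using state_out_nbr[OF sta] by blast
  have "E `` {a} \<inter> comp T x = E `` {a} - {t}"
    using t uniq comp_subset[OF st] comp_closed[OF st a] arcs_V by blast
  then show ?thesis using t out_deg[OF state_props(1)[OF sta]] finite_out by simp
qed

lemma comp_in_deg:
  assumes "state E V k T x" "a \<in> comp T x"
  shows "card (E\<inverse> `` {a} \<inter> comp T x) = k - 1"
  by (rule critical_regular.comp_out_deg[OF reversed,
        unfolded state_converse component_converse, OF assms])


section \<open>Components stay connected when a vertex is deleted\<close>

lemmas hole_in_nbr = critical_regular.hole_out_nbr[OF reversed, simplified, unfolded converse_iff]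

text \<open>If the unique out-neighbour and the unique in-neighbour of the hole in colour \<open>i\<close> lie on different
  sides of a union \<open>Q\<close> of components of that class, then no cycle of the class passes through the hole,
  and the hole can be coloured \<open>i\<close>.\<close>

lemma hole_nbrs_not_separated_aux:
  assumes h: "hole_colouring E V k c x" and i: "i < k"
    and Q: "\<And>u w. u \<in> V - {x} \<Longrightarrow> w \<in> V - {x} \<Longrightarrow> c u = i \<Longrightarrow> c w = i \<Longrightarrow> u \<in> Q \<Longrightarrow> w \<notin> Q
      \<Longrightarrow> (u, w) \<notin> E \<union> E\<inverse>"
    and y: "(x, y) \<in> E" "c y = i" "y \<notin> Q" and z: "(z, x) \<in> E" "c z = i" "z \<in> Q"
  shows False
proof -
  let ?C = "{v \<in> V - {x}. c v = i}"
  have C: "acyclic (Restr E ?C)" "finite ?C"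
    using h i finite_V by (auto simp: hole_colouring_def colours_def)
  have "E `` {x} \<inter> (?C \<inter> Q) = {}" using hole_out_nbr[OF h i] y by auto
  then have "acyclic (Restr E (insert x (?C \<inter> Q)))"
    using C no_loop acyclic_Restr_subset[OF C(1), of "?C \<inter> Q"]
    by (intro acyclic_Restr_insert) auto
  moreover have "acyclic (Restr E (?C - Q))"
    by (rule acyclic_Restr_subset[OF C(1)]) auto
  moreover have "E \<inter> (?C - Q) \<times> insert x (?C \<inter> Q) = {}"
    using hole_in_nbr[OF h i] z Q by blast
  ultimately have "acyclic (Restr E ((?C - Q) \<union> insert x (?C \<inter> Q)))"
    using C(2) by (intro acyclic_Restr_Un) auto
  moreover have "(?C - Q) \<union> insert x (?C \<inter> Q) = insert x ?C" by blast
  ultimately have "acyclic (Restr E (insert x ?C))" by (simp only:)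
  then show False using hole_class_cyclic[OF h i] by contradiction
qed

lemma hole_nbrs_not_separated:
  assumes h: "hole_colouring E V k c x" and i: "i < k"
    and Q: "\<And>u w. u \<in> V - {x} \<Longrightarrow> w \<in> V - {x} \<Longrightarrow> c u = i \<Longrightarrow> c w = i \<Longrightarrow> u \<in> Q \<Longrightarrow> w \<notin> Q
      \<Longrightarrow> (u, w) \<notin> E \<union> E\<inverse>"
    and y: "(x, y) \<in> E" "c y = i" and z: "(z, x) \<in> E" "c z = i"
  shows "y \<in> Q \<longleftrightarrow> z \<in> Q"
proof
  assume "y \<in> Q"
  show "z \<in> Q"
  proof (rule ccontr)
    assume "z \<notin> Q"
    show False
      by (rule hole_nbrs_not_separated_aux[OF h i, of "- Q", OF _ y _ z])
        (use \<open>y \<in> Q\<close> \<open>z \<notin> Q\<close> Q in blast)+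
  qed
next
  assume "z \<in> Q"
  show "y \<in> Q"
  proof (rule ccontr)
    assume "y \<notin> Q"
    show False
      by (rule hole_nbrs_not_separated_aux[OF h i Q y \<open>y \<notin> Q\<close> z \<open>z \<in> Q\<close>])
  qed
qed

text \<open>No arc joins \<open>Q\<close> to the rest of the classes \<open>i\<close> and \<open>j\<close>, so each new class is made of two acyclic sets
  without arcs between them.\<close>

lemma hole_swap:
  assumes h: "hole_colouring E V k c x" and ij: "i < k" "j < k" "i \<noteq> j"
    and Q: "\<And>u w. u \<in> V - {x} \<Longrightarrow> w \<in> V - {x} \<Longrightarrow> c u \<in> {i, j} \<Longrightarrow> c w \<in> {i, j}
      \<Longrightarrow> u \<in> Q \<Longrightarrow> w \<notin> Q \<Longrightarrow> (u, w) \<notin> E \<union> E\<inverse>"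
  shows "hole_colouring E V k
    (\<lambda>v. if v \<in> Q \<and> c v = i then j else if v \<in> Q \<and> c v = j then i else c v) x"
    (is "hole_colouring E V k ?c x")
proof -
  have x: "x \<in> V" and c: "colours E (V - {x}) k c" using h by (auto simp: hole_colouring_def)
  let ?C = "\<lambda>l. {v \<in> V - {x}. c v = l}"
  have ac: "acyclic (Restr E (?C l))" if "l < k" for l using c that by (simp add: colours_def)
  have mix: "acyclic (Restr E ((?C l - Q) \<union> (?C m \<inter> Q)))"
    if "l \<in> {i, j}" "m \<in> {i, j}" for l m
  proof (rule acyclic_Restr_Un)
    have lm: "l < k" "m < k" using that ij by auto
    show "acyclic (Restr E (?C l - Q))"
      by (rule acyclic_Restr_subset[OF ac[OF lm(1)] Diff_subset])
    show "acyclic (Restr E (?C m \<inter> Q))"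
      by (rule acyclic_Restr_subset[OF ac[OF lm(2)] inf_le1])
    show "finite (?C l - Q)" "finite (?C m \<inter> Q)" using finite_V by auto
    show "E \<inter> (?C l - Q) \<times> (?C m \<inter> Q) = {}" using Q that by blast
  qed
  have "colours E (V - {x}) k ?c"
    unfolding colours_def
  proof (intro conjI allI impI)
    show "?c ` (V - {x}) \<subseteq> {..<k}" using c ij by (auto simp: colours_def)
    fix l assume l: "l < k"
    consider "l = i" | "l = j" | "l \<noteq> i" "l \<noteq> j" by blast
    then show "acyclic (Restr E {v \<in> V - {x}. ?c v = l})"
    proof cases
      case 1
      have "{v \<in> V - {x}. ?c v = l} = (?C i - Q) \<union> (?C j \<inter> Q)" using ij \<open>l = i\<close> by auto
      moreover have "acyclic (Restr E ((?C i - Q) \<union> (?C j \<inter> Q)))" by (rule mix) simp_all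
      ultimately show ?thesis by (simp only:)
    next
      case 2
      have "{v \<in> V - {x}. ?c v = l} = (?C j - Q) \<union> (?C i \<inter> Q)" using ij \<open>l = j\<close> by auto
      moreover have "acyclic (Restr E ((?C j - Q) \<union> (?C i \<inter> Q)))" by (rule mix) simp_all
      ultimately show ?thesis by (simp only:)
    next
      case 3
      then have "{v \<in> V - {x}. ?c v = l} = ?C l" by auto
      then show ?thesis using ac[OF l] by simp
    qed
  qed
  then show ?thesis using x by (simp add: hole_colouring_def)
qed

text \<open>Suppose that deleting \<open>x\<close> splits the component. Both parts contain neighbours of \<open>x\<close>, and for each
  colour the two neighbours of \<open>x\<close> lie in the same part. Exchanging, on one part only, a colour seen there
  with a colour seen in the other part gives \<open>x\<close> two out-neighbours of the same colour.\<close>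

lemma comp_minus_connected:
  assumes st: "state E V k T x"
    and R: "R \<subseteq> comp T x - {x}" "R \<noteq> {}"
    and closed: "\<And>u w. u \<in> R \<Longrightarrow> w \<in> comp T x - {x} \<Longrightarrow> (u, w) \<in> E \<union> E\<inverse> \<Longrightarrow> w \<in> R"
  shows "R = comp T x - {x}"
proof (rule ccontr)
  assume ne: "R \<noteq> comp T x - {x}"
  obtain c j where h: "hole_colouring E V k c x" and j: "j < k"
    and T: "T = {v \<in> V - {x}. c v = j}"
    using st by (auto simp: state_def)
  have c: "c v < k" if "v \<in> V - {x}" for v
    using h that by (auto simp: hole_colouring_def colours_def)
  have sub: "comp T x \<subseteq> V - T" using comp_subset[OF st] .
  have cj: "c u < k" "c u \<noteq> j" if "u \<in> comp T x - {x}" for u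
  proof -
    have "u \<in> V - {x}" "u \<notin> T" using that sub by auto
    then show "c u < k" "c u \<noteq> j" using c[of u] T by simp_all
  qed
  have closed': "w \<in> R" if "u \<in> R" "w \<in> V - T - {x}" "(u, w) \<in> E \<union> E\<inverse>" for u w
    using closed[of u w] comp_closed[OF st, of u w] that R(1) by blast
  have reach: "\<exists>r\<in>S. (r, x) \<in> E \<union> E\<inverse>"
    if S: "S \<subseteq> comp T x - {x}" "S \<noteq> {}"
      and cl: "\<And>u w. u \<in> S \<Longrightarrow> w \<in> V - T - {x} \<Longrightarrow> (u, w) \<in> E \<union> E\<inverse> \<Longrightarrow> w \<in> S" for S
  proof (rule ccontr)
    assume no: "\<not> (\<exists>r\<in>S. (r, x) \<in> E \<union> E\<inverse>)"
    obtain a where a: "a \<in> S" using S(2) by blast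
    have "comp T a \<subseteq> S"
    proof (rule component_least[OF a])
      fix u w assume uw: "u \<in> S" "w \<in> V - T" "(u, w) \<in> E \<union> E\<inverse>"
      then have "w \<noteq> x" using no by blast
      then show "w \<in> S" using cl uw by blast
    qed
    moreover have "comp T a = comp T x" using component_eq[of a] a S(1) by blast
    moreover have "x \<in> comp T x" by (rule component_refl)
    ultimately show False using S(1) by blast
  qed
  have "\<exists>r\<in>R. (r, x) \<in> E \<union> E\<inverse>" by (rule reach[OF R]) (rule closed')
  then obtain r where r: "r \<in> R" "(r, x) \<in> E \<union> E\<inverse>" by blast
  have "\<exists>q\<in>comp T x - {x} - R. (q, x) \<in> E \<union> E\<inverse>"
  proof (rule reach)
    show "comp T x - {x} - R \<noteq> {}" using ne R(1) by blast
    fix u w assume uw: "u \<in> comp T x - {x} - R" "w \<in> V - T - {x}" "(u, w) \<in> E \<union> E\<inverse>"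
    then have "w \<in> comp T x" using comp_closed[OF st, of u w] by blast
    moreover have "w \<notin> R" using closed[of w u] uw by blast
    ultimately show "w \<in> comp T x - {x} - R" using uw by blast
  qed blast
  then obtain q where q: "q \<in> comp T x - {x} - R" "(q, x) \<in> E \<union> E\<inverse>" by blast
  have sep: "(u, w) \<notin> E \<union> E\<inverse>"
    if "u \<in> V - {x}" "w \<in> V - {x}" "c u \<noteq> j" "c w \<noteq> j" "u \<in> R" "w \<notin> R" for u w
  proof
    assume "(u, w) \<in> E \<union> E\<inverse>"
    moreover have "w \<in> V - T - {x}" using that T by simp
    ultimately have "w \<in> R" using closed' that(5) by blast
    then show False using that(6) by contradiction
  qed
  have side: "y \<in> R \<longleftrightarrow> u \<in> R"
    if u: "u \<in> comp T x - {x}" "(u, x) \<in> E \<union> E\<inverse>" and y: "(x, y) \<in> E" "c y = c u" for u y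
  proof -
    note cu = cj[OF u(1)]
    obtain z where z: "(z, x) \<in> E" "c z = c u" using hole_in_nbr[OF h cu(1)] by blast
    have "y \<in> R \<longleftrightarrow> z \<in> R"
    proof (rule hole_nbrs_not_separated[OF h cu(1) _ y z])
      fix u' w assume "u' \<in> V - {x}" "w \<in> V - {x}" "c u' = c u" "c w = c u" "u' \<in> R" "w \<notin> R"
      then show "(u', w) \<notin> E \<union> E\<inverse>" using sep[of u' w] cu(2) by simp
    qed
    moreover have "u = y \<or> u = z"
      using u(2) y z hole_in_nbr[OF h cu(1)] hole_out_nbr[OF h cu(1)] by auto
    ultimately show ?thesis by blast
  qed
  have r': "r \<in> comp T x - {x}" and q': "q \<in> comp T x - {x}" using r(1) R(1) q(1) by blast+
  note cr = cj[OF r'] and cq = cj[OF q']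
  obtain y where y: "(x, y) \<in> E" "c y = c r" using hole_out_nbr[OF h cr(1)] by blast
  obtain z where z: "(x, z) \<in> E" "c z = c q" using hole_out_nbr[OF h cq(1)] by blast
  have yR: "y \<in> R" using side[OF r' r(2) y] r(1) by blast
  have zR: "z \<notin> R" using side[OF q' q(2) z] q(1) by blast
  have neq: "c r \<noteq> c q"
  proof
    assume "c r = c q"
    then have "y = z" using hole_out_nbr[OF h cq(1)] y z by metis
    then show False using yR zR by simp
  qed
  let ?c = "\<lambda>v. if v \<in> R \<and> c v = c r then c q else if v \<in> R \<and> c v = c q then c r else c v"
  have "hole_colouring E V k ?c x"
  proof (rule hole_swap[OF h cr(1) cq(1) neq])
    fix u w assume uw: "u \<in> V - {x}" "w \<in> V - {x}" "c u \<in> {c r, c q}" "c w \<in> {c r, c q}"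
      "u \<in> R" "w \<notin> R"
    then have "c u \<noteq> j" "c w \<noteq> j" using cr(2) cq(2) by auto
    then show "(u, w) \<notin> E \<union> E\<inverse>" using sep[of u w] uw by simp
  qed
  then have "\<exists>!u. (x, u) \<in> E \<and> ?c u = c q" using hole_out_nbr cq(1) by blast
  moreover have "?c y = c q" "?c z = c q" using y z yR zR by auto
  ultimately show False using y(1) z(1) yR zR by blast
qed

text \<open>How a set left behind by the hole can reappear. If the hole \<open>w\<close> of a later configuration touches
  \<open>R\<close>, then the whole of \<open>R\<close> lies in the component of \<open>w\<close> as \<open>R\<close> is connected, and nothing but \<open>w\<close> can be added,
  as the component minus \<open>w\<close> is connected too.\<close>

lemma comp_transfer:
  assumes st: "state E V k T a" and R: "R = comp T a - {a}"
    and st': "state E V k T' w" and RV: "R \<subseteq> V - T' - {w}"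
    and closed: "\<And>u y. u \<in> R \<Longrightarrow> y \<in> V - T' - {w} \<Longrightarrow> (u, y) \<in> E \<union> E\<inverse> \<Longrightarrow> y \<in> R"
    and p: "p \<in> R" "(p, w) \<in> E \<union> E\<inverse>"
  shows "comp T' w - {w} = R"
proof -
  have "(w, p) \<in> E \<union> E\<inverse>" using p(2) by blast
  then have "p \<in> comp T' w"
    using comp_closed[OF st' component_refl, of p] p(1) RV by blast
  have "R \<inter> comp T' w = comp T a - {a}"
  proof (rule comp_minus_connected[OF st])
    show "R \<inter> comp T' w \<noteq> {}" using p(1) \<open>p \<in> comp T' w\<close> by blast
    fix u y assume "u \<in> R \<inter> comp T' w" "y \<in> comp T a - {a}" "(u, y) \<in> E \<union> E\<inverse>"
    then show "y \<in> R \<inter> comp T' w" using R RV comp_closed[OF st', of u y] by blast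
  qed (use R in blast)
  then have "R \<subseteq> comp T' w" using R by blast
  have "R = comp T' w - {w}"
  proof (rule comp_minus_connected[OF st'])
    show "R \<subseteq> comp T' w - {w}" using \<open>R \<subseteq> comp T' w\<close> RV by blast
    fix u y assume "u \<in> R" "y \<in> comp T' w - {w}" "(u, y) \<in> E \<union> E\<inverse>"
    then show "y \<in> R" using closed[of u y] comp_subset[OF st'] by blast
  qed (use p(1) in blast)
  then show ?thesis ..
qed

section \<open>A second neighbour forces a complete digraph\<close>

text \<open>Sliding the hole from \<open>v\<close> to \<open>x\<close> replaces the component \<open>R \<union> {v}\<close> by \<open>R \<union> {x}\<close>. Both are
  \<open>(k - 1)\<close>-regular, so each vertex of \<open>R\<close> has the same arcs to \<open>v\<close> as to \<open>x\<close>.\<close>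

lemma twin_out:
  assumes st: "state E V k T v" and x: "x \<in> T" "(v, x) \<in> E \<union> E\<inverse>"
    and p: "p \<in> comp T v - {v}" "(p, x) \<in> E \<union> E\<inverse>"
    and q: "q \<in> comp T v - {v}"
  shows "(q, v) \<in> E \<longleftrightarrow> (q, x) \<in> E"
proof -
  let ?T = "insert v (T - {x})" and ?R = "comp T v - {v}"
  have st': "state E V k ?T x" by (rule state_slide_in[OF st x])
  have sub: "comp T v \<subseteq> V - T" by (rule comp_subset[OF st])
  have eq: "comp ?T x - {x} = ?R"
  proof (rule comp_transfer[OF st refl st' _ _ p])
    show "?R \<subseteq> V - ?T - {x}" using sub x by blast
    fix u y assume "u \<in> ?R" "y \<in> V - ?T - {x}" "(u, y) \<in> E \<union> E\<inverse>"
    then show "y \<in> ?R" using comp_closed[OF st, of u y] by blast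
  qed
  have xR: "x \<notin> ?R" using x sub by blast
  have compv: "comp T v = insert v ?R" using component_refl[of v] by blast
  have compx: "comp ?T x = insert x ?R" using component_refl[of x] eq by blast
  have fin: "finite (E `` {q} \<inter> ?R)" using finite_out by blast
  have cv: "card (E `` {q} \<inter> insert v ?R) = k - 1"
    using comp_out_deg[OF st, of q] q compv by simp
  have cx: "card (E `` {q} \<inter> insert x ?R) = k - 1"
    using comp_out_deg[OF st', of q] q compx by simp
  have count: "card (E `` {q} \<inter> insert w ?R) =
      card (E `` {q} \<inter> ?R) + (if (q, w) \<in> E then 1 else 0)" if "w \<notin> ?R" for w
  proof (cases "(q, w) \<in> E")
    case True
    then have "E `` {q} \<inter> insert w ?R = insert w (E `` {q} \<inter> ?R)" by blast
    then show ?thesis using fin that True by simp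
  next
    case False
    then have "E `` {q} \<inter> insert w ?R = E `` {q} \<inter> ?R" by blast
    then show ?thesis using False by simp
  qed
  have "v \<notin> ?R" by blast
  from cv cx count[OF this] count[OF xR]
  have "(if (q, v) \<in> E then 1 else 0 :: nat) = (if (q, x) \<in> E then 1 else 0)" by linarith
  then show ?thesis by (cases "(q, v) \<in> E"; cases "(q, x) \<in> E") simp_all
qed

lemma twin_in:
  assumes "state E V k T v" "x \<in> T" "(v, x) \<in> E \<union> E\<inverse>"
    and "p \<in> comp T v - {v}" "(p, x) \<in> E \<union> E\<inverse>" and "q \<in> comp T v - {v}"
  shows "(v, q) \<in> E \<longleftrightarrow> (x, q) \<in> E"
  using critical_regular.twin_out[OF reversed, of T v x p q] assms by auto

text \<open>By the twin property, being joined to \<open>x\<close> by opposite arcs spreads from a vertex of the component to its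
  neighbours, so \<open>x\<close> is joined in this way to the whole component. It has only \<open>k\<close> out-neighbours, while a
  \<open>(k - 1)\<close>-regular digraph has at least \<open>k\<close> vertices. Hence the component is complete on \<open>k\<close> vertices.\<close>

lemma exists_complete_aux:
  assumes st: "state E V k T v" and x: "x \<in> T" "(v, x) \<in> E"
    and p: "p \<in> comp T v - {v}" "(p, x) \<in> E \<union> E\<inverse>"
  shows "\<exists>K\<subseteq>V. card K = Suc k \<and> complete_on E K"
proof -
  let ?A = "comp T v"
  have sub: "?A \<subseteq> V - T" by (rule comp_subset[OF st])
  have xE: "(v, x) \<in> E \<union> E\<inverse>" using x(2) by blast
  have twin_out_a: "(q, a) \<in> E \<longleftrightarrow> (q, x) \<in> E" and twin_in_a: "(a, q) \<in> E \<longleftrightarrow> (x, q) \<in> E"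
    if a: "a \<in> ?A" "(a, x) \<in> E \<union> E\<inverse>" and b: "b \<in> ?A" "b \<noteq> a" "(b, x) \<in> E \<union> E\<inverse>"
      and q: "q \<in> ?A" "q \<noteq> a" for a b q
  proof -
    have sta: "state E V k T a" by (rule state_within_comp[OF a(1) st])
    have eq: "comp T a = ?A" by (rule component_eq[OF a(1)])
    have b': "b \<in> comp T a - {a}" and q': "q \<in> comp T a - {a}" using b q eq by simp_all
    show "(q, a) \<in> E \<longleftrightarrow> (q, x) \<in> E" by (rule twin_out[OF sta x(1) a(2) b' b(3) q'])
    show "(a, q) \<in> E \<longleftrightarrow> (x, q) \<in> E"
      by (rule twin_in[OF sta x(1) a(2) b' b(3) q'])
  qed
  have vA: "v \<in> ?A" by (rule component_refl)
  have pA: "p \<in> ?A" "p \<noteq> v" using p(1) by auto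
  have "E `` {v} \<inter> ?A \<noteq> {}" using comp_out_deg[OF st vA] two_le_k by auto
  then obtain q where q: "(v, q) \<in> E" "q \<in> ?A" by blast
  have qv: "q \<noteq> v" using q no_loop by auto
  have xq: "(x, q) \<in> E" using twin_in_a[OF vA xE pA p(2) q(2) qv] q(1) by simp
  \<comment> \<open>If the arc from \<open>x\<close> to \<open>v\<close> is missing, \<open>x\<close> is a sink of \<open>T \<union> {v}\<close> and the only out-neighbour of \<open>v\<close> in \<open>T\<close>,
    so \<open>v\<close> could join the class \<open>T\<close>.\<close>
  have xv: "(x, v) \<in> E"
  proof (rule ccontr)
    assume xv: "(x, v) \<notin> E"
    have xnot: "E `` {x} \<inter> T = {}"
    proof -
      have stq: "state E V k T q" by (rule state_within_comp[OF q(2) st])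
      have "(q, x) \<in> E \<union> E\<inverse>" using xq by blast
      then have "state E V k (insert q (T - {x})) x" by (rule state_slide_in[OF stq x(1)])
      then have "\<exists>!t. (x, t) \<in> E \<and> t \<in> insert q (T - {x})" by (rule state_out_nbr)
      moreover have "q \<notin> T" using q(2) sub by blast
      ultimately have "t \<notin> T - {x}" if "(x, t) \<in> E" for t using xq that by (metis insertI1 insertI2 DiffD1)
      then show ?thesis using no_loop by blast
    qed
    have vnot: "E `` {v} \<inter> (T - {x}) = {}" using state_out_nbr[OF st] x by blast
    have fin: "finite (T - {x})" "finite (insert v (T - {x}))" using state_props(4)[OF st] by auto
    have "acyclic (Restr E (T - {x}))"
      by (rule acyclic_Restr_subset[OF state_props(5)[OF st]]) blast
    then have ac: "acyclic (Restr E (insert v (T - {x})))"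
      using vnot by (intro acyclic_Restr_insert[OF fin(1) _ no_loop] disjI1)
    have "E `` {x} \<inter> insert v (T - {x}) = {}" using xnot xv by blast
    then have "acyclic (Restr E (insert x (insert v (T - {x}))))"
      by (intro acyclic_Restr_insert[OF fin(2) ac no_loop] disjI1)
    moreover have "insert x (insert v (T - {x})) = insert v T" using x(1) by blast
    ultimately have "acyclic (Restr E (insert v T))" by (simp only:)
    then show False using state_props(6)[OF st] by contradiction
  qed
  have all: "(a, x) \<in> E \<and> (x, a) \<in> E" if "a \<in> ?A" for a
    using that
  proof (induction rule: component_induct)
    case base
    show ?case using x(2) xv by simp
  next
    case (step a w)
    have aw: "a \<noteq> w" using step no_loop by auto
    have ax: "(a, x) \<in> E \<union> E\<inverse>" using step by blast
    obtain b where b: "b \<in> ?A" "b \<noteq> a" "(b, x) \<in> E \<union> E\<inverse>"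
    proof (cases "a = v")
      case True
      then show ?thesis using that pA p(2) by blast
    next
      case False
      then show ?thesis using that vA xE by blast
    qed
    note tw = twin_out_a[OF step.hyps(1) ax b step.hyps(2) aw[symmetric]]
      twin_in_a[OF step.hyps(1) ax b step.hyps(2) aw[symmetric]]
    have wx: "(w, x) \<in> E \<union> E\<inverse>" using step.hyps(4) step.IH tw by blast
    note tw' = twin_out_a[OF step.hyps(2) wx step.hyps(1) aw ax step.hyps(1) aw]
      twin_in_a[OF step.hyps(2) wx step.hyps(1) aw ax step.hyps(1) aw]
    show ?case using tw tw' step by blast
  qed
  have finA: "finite ?A" using sub finite_V by (meson finite_Diff finite_subset)
  have xV: "x \<in> V" using x(1) state_props(2)[OF st] by blast
  have "?A \<subseteq> E `` {x}" using all by blast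
  then have le: "card ?A \<le> k" using card_mono[OF finite_out] out_deg[OF xV] by metis
  have full: "E `` {a} \<inter> ?A = ?A - {a}" if a: "a \<in> ?A" for a
  proof (rule card_seteq)
    show "E `` {a} \<inter> ?A \<subseteq> ?A - {a}" using no_loop by blast
    show "card (?A - {a}) \<le> card (E `` {a} \<inter> ?A)"
      using comp_out_deg[OF st a] le finA a by simp
  qed (use finA in simp)
  have "card ?A - 1 = k - 1" using full[OF vA] comp_out_deg[OF st vA] finA vA by (metis card_Diff_singleton)
  moreover have "card ?A > 0" using finA vA by (auto simp: card_gt_0_iff)
  ultimately have "card ?A = k" using two_le_k by linarith
  moreover have "x \<notin> ?A" using x(1) sub by blast
  ultimately have "card (insert x ?A) = Suc k" using finA by simp
  moreover have "complete_on E (insert x ?A)"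
    unfolding complete_on_def using all full by blast
  moreover have "insert x ?A \<subseteq> V" using xV sub by blast
  ultimately show ?thesis by blast
qed

lemma exists_complete:
  assumes st: "state E V k T v" and x: "x \<in> T" "(v, x) \<in> E \<union> E\<inverse>"
    and p: "p \<in> comp T v - {v}" "(p, x) \<in> E \<union> E\<inverse>"
  shows "\<exists>K\<subseteq>V. card K = Suc k \<and> complete_on E K"
proof (cases "(v, x) \<in> E")
  case True
  then show ?thesis by (rule exists_complete_aux[OF st x(1) _ p])
next
  case False
  then have "(v, x) \<in> E\<inverse>" using x(2) by blast
  moreover have "(p, x) \<in> E\<inverse> \<union> (E\<inverse>)\<inverse>" using p(2) by blast
  ultimately show ?thesis
    using critical_regular.exists_complete_aux[OF reversed, of T v x p] st x(1) p(1) by simp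
qed


section \<open>The trail of the hole\<close>

text \<open>No later hole touches \<open>M\<close>. Later configurations are described by what the argument keeps
  invariant: the vertices of \<open>T\<close> next to \<open>M\<close> stay in the distinguished class (the current hole \<open>w\<close> may be one of them,
  as it was in the class just before), and the vertices of \<open>N\<close> stay outside the class and are not the hole.\<close>

definition safe :: "'a set \<Rightarrow> 'a set \<Rightarrow> 'a set \<Rightarrow> bool" where
  "safe T N M \<longleftrightarrow> (\<forall>T' w. state E V k T' w \<longrightarrow> T \<inter> (E \<union> E\<inverse>) `` M - {w} \<subseteq> T' \<longrightarrow>
     T' \<inter> N = {} \<longrightarrow> w \<notin> N \<longrightarrow> w \<notin> (E \<union> E\<inverse>) `` M)"

lemma safeD:
  assumes "safe T N M" "state E V k T' w" "T \<inter> (E \<union> E\<inverse>) `` M - {w} \<subseteq> T'" "T' \<inter> N = {}" "w \<notin> N"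
  shows "w \<notin> (E \<union> E\<inverse>) `` M"
  using assms unfolding safe_def by blast

text \<open>Safety persists along the trail as long as no neighbour of \<open>M\<close> leaves \<open>T\<close>. A vertex
  leaves \<open>T\<close> only by becoming the hole, so this would be a hole touching \<open>M\<close>.\<close>

lemma safe_mono:
  assumes "safe T N M" "T \<inter> (E \<union> E\<inverse>) `` M \<subseteq> T'" "N \<subseteq> N'"
  shows "safe T' N' M"
  unfolding safe_def
proof (intro allI impI)
  fix T'' w assume "state E V k T'' w" "T' \<inter> (E \<union> E\<inverse>) `` M - {w} \<subseteq> T''" "T'' \<inter> N' = {}" "w \<notin> N'"
  then show "w \<notin> (E \<union> E\<inverse>) `` M" using assms(2,3) by (intro safeD[OF assms(1)]) auto
qed

lemma safe_Un:
  assumes "safe T N M" "safe T N M'"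
  shows "safe T N (M \<union> M')"
  unfolding safe_def Image_Un
proof (intro allI impI)
  fix T'' w
  assume *: "state E V k T'' w"
    "T \<inter> ((E \<union> E\<inverse>) `` M \<union> (E \<union> E\<inverse>) `` M') - {w} \<subseteq> T''" "T'' \<inter> N = {}" "w \<notin> N"
  have "w \<notin> (E \<union> E\<inverse>) `` M" using *(2) by (intro safeD[OF assms(1) *(1) _ *(3,4)]) blast
  moreover have "w \<notin> (E \<union> E\<inverse>) `` M'" using *(2) by (intro safeD[OF assms(2) *(1) _ *(3,4)]) blast
  ultimately show "w \<notin> (E \<union> E\<inverse>) `` M \<union> (E \<union> E\<inverse>) `` M'" by blast
qed

text \<open>The neighbours of \<open>R\<close> other than \<open>w\<close> are all kept in the distinguished class, so \<open>R\<close> is separated from everything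
  else by this class and \<open>w\<close>.\<close>

lemma returning_comp:
  assumes st: "state E V k T a" and R: "R = comp T a - {a}"
    and x: "x \<notin> (E \<union> E\<inverse>) `` R"
    and st': "state E V k T' w"
    and kept: "insert a (T - {x}) \<inter> (E \<union> E\<inverse>) `` R - {w} \<subseteq> T'"
    and free: "T' \<inter> R = {}" "w \<notin> R" and w: "w \<in> (E \<union> E\<inverse>) `` R"
  shows "comp T' w - {w} = R"
proof -
  have sub: "comp T a \<subseteq> V - T" by (rule comp_subset[OF st])
  obtain p where p: "p \<in> R" "(p, w) \<in> E \<union> E\<inverse>" using w by blast
  show ?thesis
  proof (rule comp_transfer[OF st R st' _ _ p])
    show "R \<subseteq> V - T' - {w}" using R sub free by blast
    fix u y assume u: "u \<in> R" and y: "y \<in> V - T' - {w}" and uy: "(u, y) \<in> E \<union> E\<inverse>"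
    have yR: "y \<in> (E \<union> E\<inverse>) `` R" using u uy by blast
    have "y \<notin> insert a (T - {x})" using kept yR y by blast
    moreover have "y \<noteq> x" using x yR by blast
    ultimately have "y \<in> V - T" "y \<noteq> a" using y by blast+
    then show "y \<in> R" using comp_closed[OF st, of u y] u uy R by blast
  qed
qed

text \<open>The invariant of the trail: \<open>M\<close> is the union of the sets left behind so far, and \<open>b\<close> is the vertex from which the hole
  last left a component, entering \<open>T\<close> at \<open>x\<close>.\<close>

definition hole_trail :: "'a set \<Rightarrow> 'a \<Rightarrow> 'a set \<Rightarrow> 'a \<Rightarrow> bool" where
  "hole_trail T x M b \<longleftrightarrow> state E V k T x \<and> M \<subseteq> V \<and> M \<inter> T = {} \<and> x \<notin> M \<and>
     (E \<union> E\<inverse>) `` M \<subseteq> M \<union> T \<and> b \<in> T \<and> (b, x) \<in> E \<and> b \<in> (E \<union> E\<inverse>) `` M \<and>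
     safe T (insert x M) M"

text \<open>Let the hole go from \<open>x\<close> to an in-neighbour \<open>a\<close> in its component and leave through \<open>a\<close>, entering \<open>T\<close> at \<open>y\<close>.
  The set \<open>R\<close> left behind contains \<open>x\<close>, and now both \<open>a\<close> and \<open>b\<close> are in-neighbours of \<open>x\<close> in the
  distinguished class. A hole \<open>w\<close> touching \<open>R\<close> would have component \<open>R \<union> {w}\<close>, where \<open>x\<close> has just
  one in-neighbour in the class; so \<open>w\<close> is \<open>a\<close> or \<open>b\<close>. But \<open>a\<close> is also adjacent to \<open>y\<close>, and \<open>b\<close> to a
  vertex of \<open>M\<close>. Neither of these lies in \<open>R\<close> or in the class, so it would belong to the component as well.\<close>

lemma hole_trail_extend:
  assumes noK: "\<not> (\<exists>K\<subseteq>V. card K = Suc k \<and> complete_on E K)" and ch: "hole_trail T x M b"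
  shows "\<exists>T' x' M' b'. hole_trail T' x' M' b' \<and> M \<subset> M'"
proof -
  have st: "state E V k T x" and MV: "M \<subseteq> V" and MT: "M \<inter> T = {}" and xM: "x \<notin> M"
    and Mcl: "(E \<union> E\<inverse>) `` M \<subseteq> M \<union> T" and b: "b \<in> T" "(b, x) \<in> E" "b \<in> (E \<union> E\<inverse>) `` M"
    and sM: "safe T (insert x M) M"
    using ch by (auto simp: hole_trail_def)
  have xV: "x \<in> V" "x \<notin> T" using state_props[OF st] by auto
  let ?A = "comp T x"
  have sub: "?A \<subseteq> V - T" by (rule comp_subset[OF st])
  have xA: "x \<in> ?A" by (rule component_refl)
  have AM: "?A \<inter> M = {}"
  proof -
    have "?A \<subseteq> V - T - M"
    proof (rule component_least)
      show "x \<in> V - T - M" using xV xM by simp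
      fix u w assume u: "u \<in> V - T - M" and w: "w \<in> V - T" and uw: "(u, w) \<in> E \<union> E\<inverse>"
      have "w \<notin> M"
      proof
        assume "w \<in> M"
        then have "u \<in> (E \<union> E\<inverse>) `` M" using uw by blast
        then show False using Mcl u by blast
      qed
      then show "w \<in> V - T - M" using w by simp
    qed
    then show ?thesis by blast
  qed
  have "E\<inverse> `` {x} \<inter> ?A \<noteq> {}"
  proof
    assume "E\<inverse> `` {x} \<inter> ?A = {}"
    then have "k - 1 = 0" using comp_in_deg[OF st xA] by simp
    then show False using two_le_k by simp
  qed
  then obtain a where a: "a \<in> ?A" "(a, x) \<in> E" by blast
  have ax: "a \<noteq> x" using a no_loop by auto
  have sta: "state E V k T a" by (rule state_within_comp[OF a(1) st])
  have eq: "comp T a = ?A" by (rule component_eq[OF a(1)])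
  have aT: "a \<in> V" "a \<notin> T" using state_props[OF sta] by auto
  obtain y where y: "(a, y) \<in> E" "y \<in> T" using state_out_nbr[OF sta] by blast
  have ay: "(a, y) \<in> E \<union> E\<inverse>" using y by blast
  define R where "R = comp T a - {a}"
  have R_A: "R = ?A - {a}" using R_def eq by simp
  let ?T = "insert a (T - {y})" and ?M = "M \<union> R"
  have st': "state E V k ?T y" by (rule state_slide_in[OF sta y(2) ay])
  have yR: "y \<notin> (E \<union> E\<inverse>) `` R"
  proof
    assume "y \<in> (E \<union> E\<inverse>) `` R"
    then obtain p where "p \<in> comp T a - {a}" "(p, y) \<in> E \<union> E\<inverse>" unfolding R_def by blast
    then show False using exists_complete[OF sta y(2) ay] noK by blast
  qed
  have xR: "x \<in> R" using R_A xA ax by simp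
  have aM: "a \<notin> M" using a AM by blast
  have yM: "y \<notin> (E \<union> E\<inverse>) `` M"
  proof (rule safeD[OF sM st'])
    show "T \<inter> (E \<union> E\<inverse>) `` M - {y} \<subseteq> ?T" by blast
    show "?T \<inter> insert x M = {}" using MT xV aM ax by blast
    show "y \<notin> insert x M" using y(2) MT xV by blast
  qed
  have bR: "b \<in> (E \<union> E\<inverse>) `` R" using b(2) xR by blast
  have by': "b \<noteq> y" using bR yR by blast
  have aR: "a \<in> (E \<union> E\<inverse>) `` R" using a(2) xR by blast
  have sR: "safe ?T (insert y ?M) R"
    unfolding safe_def
  proof (intro allI impI notI)
    fix T' w
    assume s: "state E V k T' w" and kept: "?T \<inter> (E \<union> E\<inverse>) `` R - {w} \<subseteq> T'"
      and free: "T' \<inter> insert y ?M = {}" "w \<notin> insert y ?M" and w: "w \<in> (E \<union> E\<inverse>) `` R"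
    have eqR: "comp T' w - {w} = R"
      by (rule returning_comp[OF sta R_def yR s kept _ _ w]) (use free in blast)+
    have "x \<in> comp T' w" using xR eqR by blast
    then have "\<exists>!t. (t, x) \<in> E \<and> t \<in> T'" using state_in_nbr[OF state_within_comp[OF _ s]] by blast
    moreover have "a \<noteq> b" using b(1) aT by blast
    ultimately have "a \<notin> T' \<or> b \<notin> T'" using a(2) b(2) by blast
    then have "w = a \<or> w = b" using kept aR bR b(1) by' by blast
    then show False
    proof
      assume wa: "w = a"
      have "y \<in> V - T'" using free(1) y arcs_V by blast
      then have "y \<in> comp T' w" using comp_closed[OF s component_refl, of y] wa ay by blast
      then have "y \<in> R" using eqR free(2) by blast
      then show False using R_A sub y(2) by blast
    next
      assume wb: "w = b"
      obtain z where z: "z \<in> M" "(z, b) \<in> E \<union> E\<inverse>" using b(3) by blast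
      have "z \<in> V - T'" using free(1) z(1) MV by blast
      moreover have "(w, z) \<in> E \<union> E\<inverse>" using z(2) wb by blast
      ultimately have "z \<in> comp T' w" using comp_closed[OF s component_refl, of z] by blast
      then have "z \<in> R" using eqR free(2) z(1) by blast
      then show False using R_A AM z(1) by blast
    qed
  qed
  have "hole_trail ?T y ?M a"
    unfolding hole_trail_def
  proof (intro conjI)
    show "state E V k ?T y" by (rule st')
    show "?M \<subseteq> V" using MV R_A sub by blast
    show "?M \<inter> ?T = {}" using MT aM R_A sub by blast
    show "y \<notin> ?M" using y(2) MT R_A sub by blast
    show "(E \<union> E\<inverse>) `` ?M \<subseteq> ?M \<union> ?T"
    proof
      fix w assume "w \<in> (E \<union> E\<inverse>) `` ?M"
      then consider "w \<in> (E \<union> E\<inverse>) `` M" | "w \<in> (E \<union> E\<inverse>) `` R" by blast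
      then show "w \<in> ?M \<union> ?T"
      proof cases
        case 1
        then show ?thesis using Mcl yM by blast
      next
        case 2
        then obtain u where u: "u \<in> R" "(u, w) \<in> E \<union> E\<inverse>" by blast
        then have "w \<in> V" using arcs_V by blast
        then show ?thesis using comp_closed[OF st, of u w] u R_A 2 yR by blast
      qed
    qed
    show "a \<in> ?T" by blast
    show "(a, y) \<in> E" by (rule y(1))
    show "a \<in> (E \<union> E\<inverse>) `` ?M" using aR by blast
    have "safe ?T (insert y ?M) M"
    proof (rule safe_mono[OF sM])
      show "T \<inter> (E \<union> E\<inverse>) `` M \<subseteq> ?T" using yM by blast
      show "insert x M \<subseteq> insert y ?M" using xR by blast
    qed
    then show "safe ?T (insert y ?M) ?M" using sR by (rule safe_Un)
  qed
  moreover have "M \<subset> ?M" using xR xM by blast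
  ultimately show ?thesis by blast
qed

lemma no_hole_trail:
  assumes noK: "\<not> (\<exists>K\<subseteq>V. card K = Suc k \<and> complete_on E K)"
  shows "\<not> hole_trail T x M b"
proof (induction "card (V - M)" arbitrary: T x M b rule: less_induct)
  case less
  show ?case
  proof
    assume "hole_trail T x M b"
    from hole_trail_extend[OF noK this]
    obtain T' x' M' b' where ch: "hole_trail T' x' M' b'" "M \<subset> M'" by blast
    have "M' \<subseteq> V" using ch(1) by (simp add: hole_trail_def)
    then have "V - M' \<subset> V - M" using ch(2) by blast
    then have "card (V - M') < card (V - M)" by (rule psubset_card_mono[rotated]) (simp add: finite_V)
    then have "\<not> hole_trail T' x' M' b'" by (rule less.hyps)
    then show False using ch(1) by contradiction
  qed
qed

text \<open>The first set left behind has no earlier vertex \<open>b\<close> to protect it. Instead, an in-neighbour \<open>m\<close> and an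
  out-neighbour \<open>n\<close> of \<open>a\<close> are used: in the class, \<open>m\<close> has the out-neighbours \<open>a\<close> and \<open>t\<close>, and \<open>n\<close>
  has the in-neighbours \<open>a\<close> and \<open>s\<close>. A returning hole is not \<open>a\<close>, as \<open>a\<close> is also adjacent to
  \<open>x\<close>, so it would have to be both \<open>t\<close> and \<open>s\<close>, which
  are different because neither has two neighbours in the component of \<open>a\<close>.\<close>

lemma hole_trail_start:
  assumes noK: "\<not> (\<exists>K\<subseteq>V. card K = Suc k \<and> complete_on E K)"
    and st: "state E V k T a"
    and m: "m \<in> comp T a" "(m, a) \<in> E" and n: "n \<in> comp T a" "(a, n) \<in> E" and mn: "m \<noteq> n"
  shows "\<exists>T' x M b. hole_trail T' x M b"
proof -
  define R where "R = comp T a - {a}"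
  have sub: "comp T a \<subseteq> V - T" by (rule comp_subset[OF st])
  have aT: "a \<in> V" "a \<notin> T" using state_props[OF st] by auto
  have mR: "m \<in> R" and nR: "n \<in> R" using m n no_loop R_def by auto
  have no_adj: False
    if "c \<in> comp T a" "y \<in> T" "(c, y) \<in> E \<union> E\<inverse>" "p \<in> comp T a" "p \<noteq> c" "(p, y) \<in> E \<union> E\<inverse>" for c y p
  proof -
    have "p \<in> comp T c - {c}" using that component_eq[OF that(1)] by simp
    from exists_complete[OF state_within_comp[OF that(1) st] that(2,3) this that(6)] show False
      using noK by contradiction
  qed
  obtain x where x: "(a, x) \<in> E" "x \<in> T" using state_out_nbr[OF st] by blast
  have ax: "(a, x) \<in> E \<union> E\<inverse>" using x by blast
  have xR: "x \<notin> (E \<union> E\<inverse>) `` R"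
    using no_adj[OF component_refl x(2) ax] unfolding R_def by blast
  obtain t where t: "(m, t) \<in> E" "t \<in> T"
    using state_out_nbr[OF state_within_comp[OF m(1) st]] by blast
  obtain s where s: "(s, n) \<in> E" "s \<in> T"
    using state_in_nbr[OF state_within_comp[OF n(1) st]] by blast
  have ts: "t \<noteq> s" using no_adj[OF m(1) t(2) _ n(1)] t s mn by blast
  have tR: "t \<in> (E \<union> E\<inverse>) `` R" and sR: "s \<in> (E \<union> E\<inverse>) `` R" and aR: "a \<in> (E \<union> E\<inverse>) `` R"
    using t s m(2) mR nR by blast+
  let ?T = "insert a (T - {x})"
  have st': "state E V k ?T x" by (rule state_slide_in[OF st x(2) ax])
  have "safe ?T (insert x R) R"
    unfolding safe_def
  proof (intro allI impI notI)
    fix T' w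
    assume s': "state E V k T' w" and kept: "?T \<inter> (E \<union> E\<inverse>) `` R - {w} \<subseteq> T'"
      and free: "T' \<inter> insert x R = {}" "w \<notin> insert x R" and w: "w \<in> (E \<union> E\<inverse>) `` R"
    have eqR: "comp T' w - {w} = R"
      by (rule returning_comp[OF st R_def xR s' kept _ _ w]) (use free in blast)+
    have "w \<noteq> a"
    proof
      assume wa: "w = a"
      have "x \<in> V - T'" using free(1) x arcs_V by blast
      then have "x \<in> comp T' w" using comp_closed[OF s' component_refl, of x] wa ax by blast
      then have "x \<in> R" using eqR free(2) by blast
      then show False using R_def sub x(2) by blast
    qed
    then have aT': "a \<in> T'" using kept aR by blast
    have "m \<in> comp T' w" "n \<in> comp T' w" using mR nR eqR by blast+
    then have uniq: "\<exists>!u. (m, u) \<in> E \<and> u \<in> T'" "\<exists>!u. (u, n) \<in> E \<and> u \<in> T'"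
      using state_out_nbr state_in_nbr state_within_comp[OF _ s'] by blast+
    have "t \<noteq> a" "s \<noteq> a" using t s aT by auto
    then have "t \<notin> T'" "s \<notin> T'" using uniq aT' m(2) n(2) t(1) s(1) by blast+
    moreover have "t \<noteq> x" "s \<noteq> x" using tR sR xR by auto
    ultimately have "w = t" "w = s" using kept tR sR t(2) s(2) by blast+
    then show False using ts by simp
  qed
  then have "hole_trail ?T x R a"
    unfolding hole_trail_def
  proof (intro conjI)
    show "(E \<union> E\<inverse>) `` R \<subseteq> R \<union> ?T"
    proof
      fix w assume w: "w \<in> (E \<union> E\<inverse>) `` R"
      then obtain u where u: "u \<in> R" "(u, w) \<in> E \<union> E\<inverse>" by blast
      then have "w \<in> V" using arcs_V by blast
      then show "w \<in> R \<union> ?T" using comp_closed[OF st, of u w] u R_def w xR by blast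
    qed
  qed (use st' sub R_def aT x aR in auto)
  then show ?thesis by blast
qed

text \<open>If no trail can be started at \<open>v\<close>, then for every out-neighbour \<open>u\<close> of \<open>v\<close>, and a class that avoids
  \<open>u\<close>, the vertex \<open>v\<close> has a single neighbour in its component, which is \<open>u\<close>, joined to \<open>v\<close> by
  opposite arcs. As the component is \<open>(k - 1)\<close>-regular, \<open>k = 2\<close>.\<close>

theorem complete_or_bidirected:
  "(\<exists>K\<subseteq>V. card K = Suc k \<and> complete_on E K) \<or> k = 2 \<and> sym E"
proof (rule disjCI)
  assume "\<not> (k = 2 \<and> sym E)"
  show "\<exists>K\<subseteq>V. card K = Suc k \<and> complete_on E K"
  proof (rule ccontr)
    assume noK: "\<not> (\<exists>K\<subseteq>V. card K = Suc k \<and> complete_on E K)"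
    have only: "k = 2 \<and> (u, v) \<in> E" if vu: "(v, u) \<in> E" for v u
    proof -
      have vV: "v \<in> V" and uV: "u \<in> V" and uv: "u \<noteq> v" using vu arcs_V no_loop by auto
      obtain c where h: "hole_colouring E V k c v"
        using critical[OF vV] vV by (auto simp: dicolourable_def hole_colouring_def)
      obtain j where j: "j < k" "j \<noteq> c u"
      proof (cases "c u = 0")
        case True
        then show ?thesis using that[of 1] two_le_k by simp
      next
        case False
        then show ?thesis using that[of 0] two_le_k by simp
      qed
      define T where "T = {w \<in> V - {v}. c w = j}"
      have st: "state E V k T v" unfolding state_def T_def using h j by blast
      have vA: "v \<in> comp T v" by (rule component_refl)
      have uA: "u \<in> comp T v"
        using comp_closed[OF st vA, of u] uV vu j T_def by blast
      have single: "m = n"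
        if "m \<in> comp T v" "(m, v) \<in> E" "n \<in> comp T v" "(v, n) \<in> E" for m n
        using hole_trail_start[OF noK st that] no_hole_trail[OF noK] by blast
      have "card (E\<inverse> `` {v} \<inter> comp T v) = k - 1" by (rule comp_in_deg[OF st vA])
      then have "E\<inverse> `` {v} \<inter> comp T v \<noteq> {}" using two_le_k by auto
      then obtain m where m: "m \<in> comp T v" "(m, v) \<in> E" by blast
      have "m = u" by (rule single[OF m uA vu])
      have "E `` {v} \<inter> comp T v = {u}" using single[OF m] uA vu \<open>m = u\<close> by blast
      then have "k - 1 = 1" using comp_out_deg[OF st vA] by simp
      then show ?thesis using m \<open>m = u\<close> by simp
    qed
    have "E \<noteq> {}"
    proof
      assume "E = {}"
      then have "V = {}" using out_deg two_le_k by fastforce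
      then have "dicolourable E V k" by (simp add: dicolourable_def colours_def acyclic_def)
      then show False using not_dicolourable by contradiction
    qed
    then show False using only \<open>\<not> (k = 2 \<and> sym E)\<close> unfolding sym_def by fast
  qed
qed

end

section \<open>From bounded out-degree to critical regular digraphs\<close>

lemma colours_Restr:
  assumes "S' \<subseteq> S"
  shows "colours (Restr E S) S' = colours E S'"
proof -
  have "Restr (Restr E S) {v \<in> S'. c v = i} = Restr E {v \<in> S'. c v = i}" for c :: "'a \<Rightarrow> nat" and i
    using assms by blast
  then show ?thesis unfolding colours_def fun_eq_iff by simp
qed

lemma sum_out_eq_sum_in:
  assumes "finite S"
  shows "(\<Sum>v\<in>S. card (E `` {v} \<inter> S)) = (\<Sum>v\<in>S. card (E\<inverse> `` {v} \<inter> S))"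
proof -
  have card_Restr: "card (Restr F S) = (\<Sum>v\<in>S. card (F `` {v} \<inter> S))" for F :: "('a \<times> 'a) set"
  proof -
    have "Restr F S = (SIGMA v:S. F `` {v} \<inter> S)" by blast
    then show ?thesis using assms by (simp only: card_SigmaI) simp
  qed
  have "Restr (E\<inverse>) S = (Restr E S)\<inverse>" by blast
  then have "card (Restr (E\<inverse>) S) = card (Restr E S)" by (simp only: card_inverse)
  then show ?thesis by (simp only: card_Restr)
qed

text \<open>In a minimal set that is not \<open>k\<close>-dicolourable all in- and out-degrees are at least \<open>k\<close>. The out-degrees are exactly
  \<open>k\<close>, and in- and out-degrees have the same sum.\<close>

lemma exists_critical_regular:
  assumes fin: "finite V" and loop: "\<And>v. (v, v) \<notin> E" and k: "2 \<le> k"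
    and deg: "\<And>v. v \<in> V \<Longrightarrow> card (E `` {v} \<inter> V) \<le> k" and un: "\<not> dicolourable E V k"
  shows "\<exists>S\<subseteq>V. critical_regular (Restr E S) S k"
proof -
  obtain S where S: "S \<subseteq> V" "\<not> dicolourable E S k"
    and least: "\<And>S'. S' \<subseteq> V \<Longrightarrow> \<not> dicolourable E S' k \<Longrightarrow> card S \<le> card S'"
    using ex_has_least_nat[of "\<lambda>S. S \<subseteq> V \<and> \<not> dicolourable E S k" V card] un by blast
  have finS: "finite S" using S(1) fin by (rule finite_subset)
  have crit: "dicolourable E (S - {v}) k" if "v \<in> S" for v
  proof (rule ccontr)
    assume "\<not> dicolourable E (S - {v}) k"
    then have "card S \<le> card (S - {v})" using S(1) by (intro least) auto
    moreover have "card (S - {v}) < card S" using finS that by (rule card_Diff1_less)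
    ultimately show False by simp
  qed
  have out: "card (E `` {v} \<inter> S) = k" if v: "v \<in> S" for v
  proof (rule antisym)
    show "k \<le> card (E `` {v} \<inter> S)"
      by (rule uncolourable_degree[OF finS loop S(2) v crit[OF v]])
    have "card (E `` {v} \<inter> S) \<le> card (E `` {v} \<inter> V)" using S(1) fin by (intro card_mono) auto
    also have "\<dots> \<le> k" using deg S(1) v by blast
    finally show "card (E `` {v} \<inter> S) \<le> k" .
  qed
  have in_ge: "k \<le> card (E\<inverse> `` {v} \<inter> S)" if v: "v \<in> S" for v
    using uncolourable_degree[of S v "E\<inverse>" k] finS loop S(2) v crit[OF v] by simp
  have in_eq: "card (E\<inverse> `` {v} \<inter> S) = k" if v: "v \<in> S" for v
  proof (rule ccontr)
    assume "card (E\<inverse> `` {v} \<inter> S) \<noteq> k"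
    then have "\<exists>v\<in>S. k < card (E\<inverse> `` {v} \<inter> S)" using in_ge[OF v] v by force
    then have "(\<Sum>v\<in>S. k) < (\<Sum>v\<in>S. card (E\<inverse> `` {v} \<inter> S))"
      using finS in_ge by (intro sum_strict_mono_ex1) blast+
    moreover have "(\<Sum>v\<in>S. card (E `` {v} \<inter> S)) = (\<Sum>v\<in>S. k)" using out by (intro sum.cong) auto
    ultimately show False using sum_out_eq_sum_in[OF finS, of E] by linarith
  qed
  have nbrs: "Restr E S `` {v} = E `` {v} \<inter> S" "(Restr E S)\<inverse> `` {v} = E\<inverse> `` {v} \<inter> S"
    if "v \<in> S" for v
    using that by auto
  have dic: "dicolourable (Restr E S) S' k = dicolourable E S' k" if "S' \<subseteq> S" for S'
    using colours_Restr[OF that] by (simp add: dicolourable_def)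
  have "critical_regular (Restr E S) S k"
  proof
    fix v assume v: "v \<in> S"
    show "card (Restr E S `` {v}) = k" by (simp only: nbrs(1)[OF v] out[OF v])
    show "card ((Restr E S)\<inverse> `` {v}) = k" by (simp only: nbrs(2)[OF v] in_eq[OF v])
    have "S - {v} \<subseteq> S" by blast
    then show "dicolourable (Restr E S) (S - {v}) k" using crit[OF v] dic by simp
  next
    show "\<not> dicolourable (Restr E S) S k" using S(2) dic[of S] by simp
  qed (use finS loop k in auto)
  then show ?thesis using S(1) by blast
qed

theorem directed_brooks_out_degree:
  assumes fin: "finite V" and loop: "\<And>v. (v, v) \<notin> E" and k: "2 \<le> k"
    and deg: "\<And>v. v \<in> V \<Longrightarrow> card (E `` {v} \<inter> V) \<le> k" and un: "\<not> dicolourable E V k"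
  shows "(\<exists>K\<subseteq>V. card K = Suc k \<and> complete_on E K) \<or>
    k = 2 \<and> (\<exists>S\<subseteq>V. \<not> dicolourable E S 2 \<and> sym (Restr E S))"
proof -
  obtain S where S: "S \<subseteq> V" and crit: "critical_regular (Restr E S) S k"
    using exists_critical_regular[OF assms] by blast
  from critical_regular.complete_or_bidirected[OF crit] show ?thesis
  proof
    assume "\<exists>K\<subseteq>S. card K = Suc k \<and> complete_on (Restr E S) K"
    then obtain K where "K \<subseteq> S" "card K = Suc k" "complete_on (Restr E S) K" by blast
    then have "K \<subseteq> V" "complete_on E K" using S unfolding complete_on_def by blast+
    then show ?thesis using \<open>card K = Suc k\<close> by blast
  next
    assume *: "k = 2 \<and> sym (Restr E S)"
    have "\<not> dicolourable E S k"
      using critical_regular.not_dicolourable[OF crit] colours_Restr[of S S E]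
      by (simp add: dicolourable_def)
    then show ?thesis using * S by blast
  qed
qed

section \<open>Folding a digraph along its small out-degrees\<close>

text \<open>The out-neighbours of \<open>u\<close> in the folded digraph are its out-neighbours if \<open>u \<in> X\<close>, and its
  in-neighbours otherwise. In particular an arc from \<open>X\<close> to its complement appears in both directions, and
  an arc in the other direction disappears.\<close>

definition fold_arcs :: "'a set \<Rightarrow> ('a \<times> 'a) set \<Rightarrow> ('a \<times> 'a) set" where
  "fold_arcs X E = {(u, w). if u \<in> X then (u, w) \<in> E else (w, u) \<in> E}"

lemma acyclic_fold_arcs:
  assumes fin: "finite S" and ac: "acyclic (Restr (fold_arcs X E) S)"
  shows "acyclic (Restr E S)"
proof -
  let ?F = "fold_arcs X E"
  have "Restr E (S \<inter> X) = Restr ?F (S \<inter> X)" by (auto simp: fold_arcs_def)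
  moreover have "acyclic (Restr ?F (S \<inter> X))" by (rule acyclic_Restr_subset[OF ac]) blast
  ultimately have 1: "acyclic (Restr E (S \<inter> X))" by (simp only:)
  have "Restr E (S - X) = Restr (?F\<inverse>) (S - X)" by (auto simp: fold_arcs_def)
  moreover have "acyclic (Restr (?F\<inverse>) (S - X))"
    unfolding acyclic_Restr_converse by (rule acyclic_Restr_subset[OF ac Diff_subset])
  ultimately have 2: "acyclic (Restr E (S - X))" by (simp only:)
  have "E \<inter> (S \<inter> X) \<times> (S - X) = {}"
  proof (rule ccontr)
    assume "E \<inter> (S \<inter> X) \<times> (S - X) \<noteq> {}"
    then obtain u w where "u \<in> S" "w \<in> S" "u \<in> X" "w \<notin> X" "(u, w) \<in> E" by blast
    then have "(u, w) \<in> Restr ?F S" "(w, u) \<in> Restr ?F S" by (auto simp: fold_arcs_def)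
    then have "(u, u) \<in> (Restr ?F S)\<^sup>+" by (rule trancl.intros(2)[OF trancl.intros(1)])
    then show False using ac unfolding acyclic_def by blast
  qed
  then have "acyclic (Restr E ((S \<inter> X) \<union> (S - X)))"
    using fin by (intro acyclic_Restr_Un 1 2) auto
  moreover have "(S \<inter> X) \<union> (S - X) = S" by blast
  ultimately show ?thesis by (simp only:)
qed

lemma complete_on_fold_arcs:
  assumes "complete_on (fold_arcs X E) K" and "K \<subseteq> X \<or> K \<inter> X = {}"
  shows "complete_on E K"
  unfolding complete_on_def
proof (intro ballI impI)
  fix u w assume "u \<in> K" "w \<in> K" "u \<noteq> w"
  then have "(u, w) \<in> fold_arcs X E" "(w, u) \<in> fold_arcs X E"
    using assms(1) by (auto simp: complete_on_def)
  then show "(u, w) \<in> E"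
    using assms(2) \<open>u \<in> K\<close> \<open>w \<in> K\<close> by (auto simp: fold_arcs_def split: if_splits)
qed

text \<open>The size is \<open>\<lceil>(k + 1) / 2\<rceil>\<close>. For \<open>k < 2\<close> it is 1, and a vertex suffices.\<close>

theorem half_clique_if_not_dicolourable:
  assumes fin: "finite V" and arcs: "E \<subseteq> V \<times> V" and loop: "\<And>v. (v, v) \<notin> E"
    and deg: "\<And>v. v \<in> V \<Longrightarrow> min (card (E `` {v})) (card (E\<inverse> `` {v})) \<le> k"
    and un: "\<not> dicolourable E V k"
  shows "\<exists>K\<subseteq>V. card K = (k + 2) div 2 \<and> complete_on E K"
proof (cases "2 \<le> k")
  case False
  have "V \<noteq> {}"
  proof
    assume "V = {}"
    then have "dicolourable E V k" by (simp add: dicolourable_def colours_def acyclic_def)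
    then show False using un by contradiction
  qed
  then obtain v where "v \<in> V" by blast
  moreover have "complete_on E {v}" by (simp add: complete_on_def)
  moreover have "(k + 2) div 2 = 1" using False by auto
  ultimately show ?thesis by (intro exI[of _ "{v}"]) simp
next
  case True
  define X where "X = {v \<in> V. card (E `` {v}) \<le> k}"
  let ?F = "fold_arcs X E"
  have loopF: "(v, v) \<notin> ?F" for v using loop by (simp add: fold_arcs_def)
  have degF: "card (?F `` {v} \<inter> V) \<le> k" if v: "v \<in> V" for v
  proof -
    have "card (?F `` {v}) \<le> k"
    proof (cases "v \<in> X")
      case True
      then have "?F `` {v} = E `` {v}" by (auto simp: fold_arcs_def)
      then show ?thesis using True by (simp add: X_def)
    next
      case False
      then have "?F `` {v} = E\<inverse> `` {v}" by (auto simp: fold_arcs_def)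
      moreover have "\<not> card (E `` {v}) \<le> k" using False v by (simp add: X_def)
      then have "card (E\<inverse> `` {v}) \<le> k" using deg[OF v] by linarith
      ultimately show ?thesis by (simp only:)
    qed
    moreover have "finite (?F `` {v})"
      by (rule finite_subset[OF _ fin]) (use arcs in \<open>auto simp: fold_arcs_def split: if_splits\<close>)
    then have "card (?F `` {v} \<inter> V) \<le> card (?F `` {v})" by (intro card_mono) auto
    ultimately show ?thesis by linarith
  qed
  have unF: "\<not> dicolourable ?F V k"
  proof
    assume "dicolourable ?F V k"
    then obtain c where c: "colours ?F V k c" by (auto simp: dicolourable_def)
    have "acyclic (Restr E {v \<in> V. c v = i})" if "i < k" for i
      by (rule acyclic_fold_arcs[of _ X]) (use fin c that in \<open>auto simp: colours_def\<close>)
    then have "colours E V k c" using c by (simp add: colours_def)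
    then show False using un by (auto simp: dicolourable_def)
  qed
  have one_side: ?thesis
    if K: "K \<subseteq> V" "complete_on ?F K" "(k + 2) div 2 \<le> card K" "K \<subseteq> X \<or> K \<inter> X = {}" for K
  proof -
    obtain K' where K': "K' \<subseteq> K" "card K' = (k + 2) div 2"
      using obtain_subset_with_card_n[OF K(3)] by blast
    have "complete_on E K" by (rule complete_on_fold_arcs[OF K(2,4)])
    then have "complete_on E K'" using K'(1) unfolding complete_on_def by blast
    then show ?thesis using K' K(1) by blast
  qed
  from directed_brooks_out_degree[OF fin loopF True degF unF] show ?thesis
  proof
    assume "\<exists>K\<subseteq>V. card K = Suc k \<and> complete_on ?F K"
    then obtain K where K: "K \<subseteq> V" "card K = Suc k" "complete_on ?F K" by blast
    have "finite K" using K(1) fin by (rule finite_subset)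
    then have "card (K \<inter> X) + card (K - X) = Suc k"
      using K(2) by (metis card_Un_disjoint Int_Diff_disjoint Int_Diff_Un finite_Diff finite_Int)
    then consider "(k + 2) div 2 \<le> card (K \<inter> X)" | "(k + 2) div 2 \<le> card (K - X)" by linarith
    then show ?thesis
    proof cases
      case 1
      show ?thesis by (rule one_side[OF _ _ 1]) (use K in \<open>auto simp: complete_on_def\<close>)
    next
      case 2
      show ?thesis by (rule one_side[OF _ _ 2]) (use K in \<open>auto simp: complete_on_def\<close>)
    qed
  next
    assume "k = 2 \<and> (\<exists>S\<subseteq>V. \<not> dicolourable ?F S 2 \<and> sym (Restr ?F S))"
    then obtain S where k: "k = 2" and S: "S \<subseteq> V" "\<not> dicolourable ?F S 2" "sym (Restr ?F S)" by blast
    define c where "c = (\<lambda>v. if v \<in> X then 0 else 1 :: nat)"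
    have "\<not> colours ?F S 2 c" using S(2) by (auto simp: dicolourable_def)
    moreover have "c ` S \<subseteq> {..<2}" by (auto simp: c_def)
    ultimately obtain i where i: "\<not> acyclic (Restr ?F {v \<in> S. c v = i})"
      unfolding colours_def by blast
    have "Restr ?F {v \<in> S. c v = i} \<noteq> {}"
    proof
      assume "Restr ?F {v \<in> S. c v = i} = {}"
      then have "acyclic (Restr ?F {v \<in> S. c v = i})" by (simp only: acyclic_def trancl_empty) simp
      then show False using i by contradiction
    qed
    then obtain u w where "(u, w) \<in> ?F" "u \<in> {v \<in> S. c v = i}" "w \<in> {v \<in> S. c v = i}"
      by blast
    then have uw: "(u, w) \<in> ?F" "u \<in> S" "w \<in> S" "c u = c w" by simp_all
    then have "(w, u) \<in> ?F" using S(3) unfolding sym_def by blast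
    then have "complete_on ?F {u, w}" using uw(1) by (simp add: complete_on_def)
    moreover have "u \<noteq> w" using uw(1) loopF by blast
    moreover have "{u, w} \<subseteq> X \<or> {u, w} \<inter> X = {}" using uw(4) by (simp add: c_def split: if_splits)
    ultimately show ?thesis using uw(2,3) S(1) k by (intro one_side[of "{u, w}"]) auto
  qed
qed

section \<open>Digraphs as arc relations\<close>

lemma acyclic_digraph_if_acyclic_arcs_ends:
  assumes "wf_digraph G" "acyclic (arcs_ends G)"
  shows "acyclic_digraph G"
proof -
  interpret wf_digraph G by (rule assms(1))
  have "\<not> cycle p" for p
  proof
    assume "cycle p"
    then obtain u where "awalk u p u" "p \<noteq> []" by (auto simp: cycle_def)
    then have "(u, u) \<in> (arcs_ends G)\<^sup>+" using reachable1_awalkI by blast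
    then show False using assms(2) by (simp add: acyclic_def)
  qed
  then show ?thesis by (simp add: acyclic_digraph_def)
qed

lemma arcs_ends_induce_subgraph: "arcs_ends (G \<restriction> S) = Restr (arcs_ends G) S"
  by (auto simp: arcs_ends_conv)

text \<open>The shift accounts for colours starting from 0 on one side and from 1 on the other.\<close>

lemma dicolouring_if_colours:
  assumes "wf_digraph D" "colours (arcs_ends D) (verts D) k c"
  shows "dicolouring D k (\<lambda>v. Suc (c v))"
  unfolding dicolouring_def
proof (intro conjI ballI)
  show "(\<lambda>v. Suc (c v)) ` verts D \<subseteq> {1..k}" using assms(2) by (auto simp: colours_def)
  fix i assume i: "i \<in> {1..k}"
  let ?S = "{v \<in> verts D. Suc (c v) = i}"
  have S: "?S = {v \<in> verts D. c v = i - 1}" using i by auto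
  have "i - 1 < k" using i by auto
  then have "acyclic (Restr (arcs_ends D) ?S)" unfolding S using assms(2) by (simp add: colours_def)
  then have "acyclic (arcs_ends (D \<restriction> ?S))" by (simp only: arcs_ends_induce_subgraph)
  moreover have "wf_digraph (D \<restriction> ?S)" using assms(1) by (rule wf_digraph.wellformed_induce_subgraph)
  ultimately show "acyclic_digraph (D \<restriction> ?S)" by (intro acyclic_digraph_if_acyclic_arcs_ends)
qed

lemma complete_digraph_induce_subgraph:
  assumes "digraph D" "K \<subseteq> verts D" "complete_on (arcs_ends D) K"
  shows "complete_digraph (card K) (D \<restriction> K)"
proof -
  interpret digraph D by (rule assms(1))
  interpret K: digraph "D \<restriction> K" by (rule digraphI_induced[OF induced_induce[OF assms(2)]])
  have ends: "arcs_ends (D \<restriction> K) = {(u, v). (u, v) \<in> K \<times> K \<and> u \<noteq> v}"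
    unfolding arcs_ends_induce_subgraph
    using assms(3) adj_not_same by (auto simp: complete_on_def)
  then have "symmetric (D \<restriction> K)" unfolding symmetric_def by (auto intro: symI)
  then have "graph (D \<restriction> K)" by (rule K.graphI)
  then show ?thesis using ends by (simp add: complete_digraph_def)
qed

theorem corollary7:
  fixes D :: "('a, 'b) pre_digraph"
  assumes "digraph D"
    and "dichromatic_number D = Delta_min D + 1"
  shows "\<exists>H. subgraph H D \<and> complete_digraph (nat \<lceil>(real (Delta_min D) + 1) / 2\<rceil>) H"
proof -
  interpret digraph D by (rule assms(1))
  let ?k = "Delta_min D" and ?E = "arcs_ends D"
  have un: "\<not> dicolourable ?E (verts D) ?k"
  proof
    assume "dicolourable ?E (verts D) ?k"
    then obtain c where "colours ?E (verts D) ?k c" by (auto simp: dicolourable_def)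
    from dicolouring_if_colours[OF wf_digraph this]
    have "dichromatic_number D \<le> ?k" unfolding dichromatic_number_def by (intro Least_le exI)
    then show False using assms(2) by simp
  qed
  have deg: "min (card (?E `` {v})) (card (?E\<inverse> `` {v})) \<le> ?k" if v: "v \<in> verts D" for v
  proof -
    have "?E `` {v} = head D ` out_arcs D v" "?E\<inverse> `` {v} = tail D ` in_arcs D v"
      by (auto simp: arcs_ends_conv)
    then have "card (?E `` {v}) \<le> out_degree D v" "card (?E\<inverse> `` {v}) \<le> in_degree D v"
      unfolding out_degree_def in_degree_def by (simp_all add: card_image_le finite_out_arcs finite_in_arcs)
    moreover have "min (out_degree D v) (in_degree D v) \<le> ?k"
      unfolding Delta_min_def using v by (intro Max_ge) auto
    ultimately show ?thesis by linarith
  qed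
  have "\<exists>K\<subseteq>verts D. card K = (?k + 2) div 2 \<and> complete_on ?E K"
  proof (rule half_clique_if_not_dicolourable[OF finite_verts _ _ deg un])
    show "?E \<subseteq> verts D \<times> verts D" by (auto simp: arcs_ends_conv)
    show "(v, v) \<notin> ?E" for v using adj_not_same by blast
  qed
  then obtain K where K: "K \<subseteq> verts D" "card K = (?k + 2) div 2" "complete_on ?E K" by blast
  have "nat \<lceil>(real ?k + 1) / 2\<rceil> = (?k + 2) div 2"
  proof -
    define q where "q = (?k + 2) div 2"
    have "2 * q \<le> ?k + 2" "?k + 1 \<le> 2 * q" unfolding q_def by linarith+
    then have "2 * real q \<le> real ?k + 2" "real ?k + 1 \<le> 2 * real q" by linarith+
    then have "\<lceil>(real ?k + 1) / 2\<rceil> = int q" by (intro ceiling_unique) simp_all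
    then show ?thesis by (simp add: q_def)
  qed
  then have "complete_digraph (nat \<lceil>(real ?k + 1) / 2\<rceil>) (D \<restriction> K)"
    using complete_digraph_induce_subgraph[OF assms(1) K(1,3)] K(2) by simp
  moreover have "subgraph (D \<restriction> K) D" by (rule subgraph_induce_subgraphI[OF K(1)])
  ultimately show ?thesis by blast
qed

end
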